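(* Let $a>0$, and for integers $n\ge1$ and $h$ let $V(h,n,a,b,x)$ denote the indefinite integral $$V(h,n,a,b,x)=\sqrt{\tfrac{2}{\pi}}\int e^{-ax^{2}}b^{n+\frac12}x^{h+\frac12}\,\tfrac12\,G_{0,2}^{2,0}\left(\tfrac{b^{2}x^{2}}{4}\,\Big|\,\tfrac n2+\tfrac14,-\tfrac n2-\tfrac14\right)dx=\sqrt{\tfrac{2}{\pi}}\int e^{-ax^{2}}b^{n+\frac12}x^{h+\frac12}K_{n+\frac12}(bx)\,dx=b^{n}\int x^{h}p_n(bx)\,e^{-ax^{2}-bx}\,dx,$$ where $p_1(z)=\frac1z+1$, $p_2(z)=\frac{3}{z^2}+\frac3z+1$, $p_3(z)=\frac{15}{z^3}+\frac{15}{z^2}+\frac6z+1$, $p_4(z)=\frac{105}{z^4}+\frac{105}{z^3}+\frac{45}{z^2}+\frac{10}{z}+1$. For $(h,n)=(0,1)$ the Meijer G form of the integral may equally be written $\int\sqrt{\frac2\pi}\,\frac{b^{5/2}}{2^{2}}e^{-ax^{2}}x^{\frac12+1}G_{0,2}^{2,0}\left(\frac{b^{2}x^{2}}{4}\,\big|\,\frac14,-\frac54\right)dx$. Write $\Upsilon(\upsilon)=\Upsilon(\upsilon,a,b,x)$ (defined in the context) and $$V(1,0,a,b,x)=\int xe^{-ax^{2}-bx}dx=-\frac{e^{-ax^{2}-bx}}{2a}-\frac{\sqrt\pi\,b\,e^{\frac{b^{2}}{4a}}\operatorname{erf}\left(\frac{2ax+b}{2\sqrt a}\right)}{4a^{3/2}}.$$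 Then $$V(0,1,a,b,x)=\Upsilon(1)+b\,\Upsilon(0),$$ $$V(-1,2,a,b,x)=3\Upsilon(3)+3b\,\Upsilon(2)+b^{2}\,\Upsilon(1),$$ $$V(0,3,a,b,x)=15\Upsilon(2)+15b\,\Upsilon(1)+6b^{2}\,\Upsilon(0)+b^{3}\,V(1,0,a,b,x),$$ $$V(-2,3,a,b,x)=15\Upsilon(5)+15b\,\Upsilon(4)+6b^{2}\,\Upsilon(3)+b^{3}\,\Upsilon(2),$$ $$V(1,4,a,b,x)=105\Upsilon(3)+105b\,\Upsilon(2)+45b^{2}\,\Upsilon(1)+10b^{3}\,\Upsilon(0)+b^{4}\,V(1,0,a,b,x),$$ $$V(-1,4,a,b,x)=105\Upsilon(5)+105b\,\Upsilon(4)+45b^{2}\,\Upsilon(3)+10b^{3}\,\Upsilon(2)+b^{4}\,\Upsilon(1),$$ $$V(-3,4,a,b,x)=105\Upsilon(7)+105b\,\Upsilon(6)+45b^{2}\,\Upsilon(5)+10b^{3}\,\Upsilon(4)+b^{4}\,\Upsilon(3).$$ In the formulas for $V(0,1,a,b,x)$ and $V(1,4,a,b,x)$, $\Upsilon(0)$ can also be written as $V(0,0,a,b,x)=\int e^{-ax^{2}-bx}dx=\frac{\sqrt\pi}{2\sqrt a}e^{\frac{b^{2}}{4a}}\operatorname{erf}\left(\frac{2ax+b}{2\sqrt a}\right)$.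
   Context: $K_\mu$ is the Macdonald function (modified Bessel function of the second kind), $G_{0,2}^{2,0}(z\,|\,\beta_1,\beta_2)$ the Meijer G-function with no upper parameters and lower parameters $\beta_1,\beta_2$, $\operatorname{erf}(z)=\frac{2}{\sqrt\pi}\int_0^z e^{-t^2}dt$, and $\Gamma(s,z)=\int_z^\infty t^{s-1}e^{-t}dt$ the upper incomplete gamma function. For $x>0$, $$\Upsilon(\upsilon,a,b,x)=\int\frac{e^{-ax^{2}-bx}}{x^{\upsilon}}dx=\sum_{k=0}^{\infty}\left(\frac{b^{2k+1}a^{-k+\frac{\upsilon}{2}-1}\Gamma\left(k-\frac{\upsilon}{2}+1,ax^{2}\right)}{2(2k+1)!}-\frac{b^{2k}a^{-k+\frac{\upsilon}{2}-\frac12}\Gamma\left(k-\frac{\upsilon}{2}+\frac12,ax^{2}\right)}{2(2k)!}\right).$$ Roots are read with $\sqrt{b^{2}x^{2}}=bx$ and $\sqrt{bx}=\sqrt b\sqrt x$. All equalities are between indefinite integrals in $x$, i.e. up to additive constants.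
   Formalization: The printed formula for V(0,3) is false: its right side has derivative x times the integrand. Proved instead: V(1,3) equals the printed right side, and V(0,3)=15Υ(3)+15bΥ(2)+6b²Υ(1)+b³Υ(0). b is any nonzero complex number. *)

theory Defs
  imports "HOL-Complex_Analysis.Complex_Analysis"
begin

text \<open>
  An indefinite integral in \<open>x > 0\<close> is the set of all antiderivatives on the positive half-line.
  An equality ``\<open>\<integral>f dx = R(x)\<close> up to an additive constant'' is the set equality
  \<open>indefinite_integral f = up_to_constant R\<close>; it implies that \<open>R\<close> is itself an antiderivative.
  Values at \<open>x \<le> 0\<close> are irrelevant on both sides.
\<close>

definition indefinite_integral :: "(real \<Rightarrow> complex) \<Rightarrow> (real \<Rightarrow> complex) set" where
  "indefinite_integral f = {F. \<forall>x>0. (F has_vector_derivative f x) (at x)}"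

definition up_to_constant :: "(real \<Rightarrow> complex) \<Rightarrow> (real \<Rightarrow> complex) set" where
  "up_to_constant R = {F. \<exists>c. \<forall>x>0. F x = R x + c}"

definition bessel_I :: "complex \<Rightarrow> complex \<Rightarrow> complex" where
  "bessel_I \<nu> z = (z / 2) powr \<nu> *
     (\<Sum>k. (z / 2) ^ (2 * k) * rGamma (\<nu> + of_nat k + 1) / fact k)"

text \<open>
  All powers are principal, so for \<open>x > 0\<close> and every \<open>b \<noteq> 0\<close> one has
  \<open>(b x)\<^sup>\<mu> = b\<^sup>\<mu> x\<^sup>\<mu>\<close>; in particular the square root of \<open>b x\<close> is the product of the roots.
\<close>

definition macdonald_K :: "complex \<Rightarrow> complex \<Rightarrow> complex" where
  "macdonald_K \<nu> z =
     (let K = (\<lambda>\<mu>. complex_of_real pi / 2 * (bessel_I (- \<mu>) z - bessel_I \<mu> z) / sin (\<mu> * complex_of_real pi))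
      in if \<nu> \<in> \<int> then Lim (at \<nu>) K else K \<nu>)"

text \<open>
  The function $G^{2,0}_{0,2}$ as a Mellin--Barnes integral over the loop that begins and ends at
  \<open>+\<infinity>\<close> and encircles all poles of \<open>\<Gamma>(\<beta>\<^sub>1 - s) \<Gamma>(\<beta>\<^sub>2 - s)\<close> once clockwise.
  With fewer upper than lower parameters this converges for all \<open>z \<noteq> 0\<close> on the Riemann surface of
  the logarithm. The argument \<open>L\<close> is the chosen value of \<open>log z\<close>, so that \<open>z\<^sup>s = exp (s L)\<close>.
\<close>

definition meijer_G2002_log :: "complex \<Rightarrow> complex \<Rightarrow> complex \<Rightarrow> complex" where
  "meijer_G2002_log L \<beta>1 \<beta>2 =
     (let \<sigma> = min (Re \<beta>1) (Re \<beta>2) - 1;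
          \<tau> = max \<bar>Im \<beta>1\<bar> \<bar>Im \<beta>2\<bar> + 1
      in Lim at_top (\<lambda>R::real. 1 / (2 * complex_of_real pi * \<i>) *
           contour_integral
             (linepath (Complex R (- \<tau>)) (Complex \<sigma> (- \<tau>)) +++
              linepath (Complex \<sigma> (- \<tau>)) (Complex \<sigma> \<tau>) +++
              linepath (Complex \<sigma> \<tau>) (Complex R \<tau>))
             (\<lambda>s. Gamma (\<beta>1 - s) * Gamma (\<beta>2 - s) * exp (s * L))))"

definition meijer_G2002 :: "complex \<Rightarrow> complex \<Rightarrow> complex \<Rightarrow> complex" where
  "meijer_G2002 z \<beta>1 \<beta>2 = meijer_G2002_log (Ln z) \<beta>1 \<beta>2"

text \<open>
  \<open>G(b\<^sup>2x\<^sup>2/4 | \<beta>\<^sub>1, \<beta>\<^sub>2)\<close> with the branch on which the square root of \<open>b\<^sup>2x\<^sup>2\<close> is \<open>b x\<close>.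
\<close>

definition meijer_G_bx :: "complex \<Rightarrow> real \<Rightarrow> complex \<Rightarrow> complex \<Rightarrow> complex" where
  "meijer_G_bx b x \<beta>1 \<beta>2 = meijer_G2002_log (2 * Ln (b * complex_of_real x / 2)) \<beta>1 \<beta>2"

text \<open>For \<open>Re b > 0\<close>, in particular for real \<open>b > 0\<close>, this is the principal branch.\<close>

lemma meijer_G_bx_principal:
  assumes "Re b > 0" and "x > 0"
  shows "meijer_G_bx b x \<beta>1 \<beta>2 = meijer_G2002 (b\<^sup>2 * (complex_of_real x)\<^sup>2 / 4) \<beta>1 \<beta>2"
proof -
  define w where "w = b * complex_of_real x / 2"
  have w: "Re w > 0"
    using assms by (simp add: w_def)
  then have w0: "w \<noteq> 0"
    by auto
  have "\<bar>Im (Ln w)\<bar> < pi / 2"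
    using Re_Ln_pos_lt[OF w0] w by simp
  then have "Ln (w * w) = Ln w + Ln w"
    using Ln_times_simple[of w w] w0 by auto
  moreover have "b\<^sup>2 * (complex_of_real x)\<^sup>2 / 4 = w * w"
    by (simp add: w_def power2_eq_square)
  ultimately show ?thesis
    by (simp add: meijer_G_bx_def meijer_G2002_def w_def[symmetric])
qed

definition erf :: "complex \<Rightarrow> complex" where
  "erf z = 2 / complex_of_real (sqrt pi) * contour_integral (linepath 0 z) (\<lambda>t. exp (- t\<^sup>2))"

definition upper_Gamma :: "real \<Rightarrow> real \<Rightarrow> real" where
  "upper_Gamma s z = integral {z..} (\<lambda>t. t powr (s - 1) * exp (- t))"

definition Upsilon_term :: "real \<Rightarrow> real \<Rightarrow> complex \<Rightarrow> real \<Rightarrow> nat \<Rightarrow> complex" where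
  "Upsilon_term \<upsilon> a b x k =
     b ^ (2 * k + 1) * complex_of_real (a powr (- real k + \<upsilon> / 2 - 1)) *
       complex_of_real (upper_Gamma (real k - \<upsilon> / 2 + 1) (a * x\<^sup>2)) / (2 * fact (2 * k + 1))
   - b ^ (2 * k) * complex_of_real (a powr (- real k + \<upsilon> / 2 - 1 / 2)) *
       complex_of_real (upper_Gamma (real k - \<upsilon> / 2 + 1 / 2) (a * x\<^sup>2)) / (2 * fact (2 * k))"

definition Upsilon :: "real \<Rightarrow> real \<Rightarrow> complex \<Rightarrow> real \<Rightarrow> complex" where
  "Upsilon \<upsilon> a b x = (\<Sum>k. Upsilon_term \<upsilon> a b x k)"

definition gauss_exp :: "real \<Rightarrow> complex \<Rightarrow> real \<Rightarrow> complex" where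
  "gauss_exp a b x = exp (- complex_of_real (a * x\<^sup>2) - b * complex_of_real x)"

text \<open>
  Pitfall: \<open>15 \<Upsilon>(2) + 15 b \<Upsilon>(1) + 6 b\<^sup>2 \<Upsilon>(0) + b\<^sup>3 V(1,0)\<close> has derivative
  \<open>b\<^sup>3 x p\<^sub>3(b x) exp (- a x\<^sup>2 - b x)\<close>, so it represents \<open>V(1,3)\<close>. The source prints it for
  \<open>V(0,3)\<close>, for which every index of \<open>\<Upsilon>\<close> is one larger and \<open>V(1,0)\<close> becomes \<open>\<Upsilon>(0)\<close>.
\<close>

definition V :: "int \<Rightarrow> nat \<Rightarrow> real \<Rightarrow> complex \<Rightarrow> (real \<Rightarrow> complex) set" where
  "V h n a b = indefinite_integral (\<lambda>x.
     complex_of_real (sqrt (2 / pi)) * complex_of_real (exp (- a * x\<^sup>2)) *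
     b powr (of_nat n + 1 / 2) * complex_of_real (x powr (of_int h + 1 / 2)) *
     macdonald_K (of_nat n + 1 / 2) (b * complex_of_real x))"

text \<open>Only the values for \<open>n = 1, 2, 3, 4\<close> are meaningful.\<close>

definition p :: "nat \<Rightarrow> complex \<Rightarrow> complex" where
  "p n z =
     (if n = 1 then 1 / z + 1
      else if n = 2 then 3 / z^2 + 3 / z + 1
      else if n = 3 then 15 / z^3 + 15 / z^2 + 6 / z + 1
      else if n = 4 then 105 / z^4 + 105 / z^3 + 45 / z^2 + 10 / z + 1
      else undefined)"

text \<open>The closed forms given for the indefinite integrals \<open>V(0,0)\<close> and \<open>V(1,0)\<close>.\<close>

definition V00 :: "real \<Rightarrow> complex \<Rightarrow> real \<Rightarrow> complex" where
  "V00 a b x = complex_of_real (sqrt pi / (2 * sqrt a)) * exp (b\<^sup>2 / (4 * complex_of_real a)) *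
     erf ((2 * complex_of_real (a * x) + b) / (2 * complex_of_real (sqrt a)))"

definition V10 :: "real \<Rightarrow> complex \<Rightarrow> real \<Rightarrow> complex" where
  "V10 a b x = - gauss_exp a b x / (2 * complex_of_real a)
     - complex_of_real (sqrt pi) * b * exp (b\<^sup>2 / (4 * complex_of_real a)) *
       erf ((2 * complex_of_real (a * x) + b) / (2 * complex_of_real (sqrt a)))
       / (4 * complex_of_real (a powr (3 / 2)))"

end

theory Submission
  imports Defs
begin

text \<open>
  The loop integral of \<open>\<Gamma>(\<beta>\<^sub>1 - s) \<Gamma>(\<beta>\<^sub>2 - s) exp (s L)\<close> is closed by vertical edges moving to the right.
  The functional equation of \<open>\<Gamma>\<close> halves the integrand under \<open>s \<mapsto> s + 1\<close> far enough to the right, so the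
  edges contribute nothing in the limit and the loop integral is the sum of the residues; these
  are the terms of the two Bessel series in \<open>2 K\<^sub>\<nu>\<close>. For half-integer \<open>\<nu>\<close> the function \<open>K\<^sub>\<nu>\<close> is
  elementary, by the values at \<open>\<plusminus>1/2\<close> and the three-term recurrence. All remaining claims are
  checked by differentiation: termwise, \<open>\<Upsilon>(\<upsilon>)\<close> has the exponential series of
  \<open>exp (- b x)\<close> times \<open>x powr (- \<upsilon>) exp (- a x\<^sup>2)\<close> as its derivative.
\<close>

section \<open>Macdonald functions of half-integer order\<close>

text \<open>That the lower parameters differ by a half-integer shapes the argument. The two pole
  families are then disjoint, so every pole is simple and no logarithmic terms arise; vertical edges
  can pass between the poles of both families; and the quotient defining \<open>macdonald_K\<close>
  needs no limit. Decay on the edges is obtained without Stirling asymptotics: the integrand is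
  bounded by compactness on the boundary of one unit-wide rectangle, and the functional equation
  carries this bound to the right. This gives convergence only along a sequence of right ends,
  whereas \<open>meijer_G2002_log\<close> takes a limit over all real ones, so a separate comparison
  fills the gaps. The Bessel side and the \<open>Upsilon\<close> side meet only in the integrand of
  \<open>V\<close>: once K is elementary, the integrand is a combination of powers of x times
  \<open>gauss_exp\<close>. Negative powers lead to incomplete Gamma functions with nonpositive
  first argument, where the complete Gamma integral diverges; hence the care with integrability and
  with the first terms of the series.\<close>

lemma bessel_series_summable:
  fixes \<nu> q :: complex
  shows "summable (\<lambda>k. q ^ (2 * k) * rGamma (\<nu> + of_nat k + 1) / fact k)"
proof -
  define t where "t = (\<lambda>k. q ^ (2 * k) * rGamma (\<nu> + of_nat k + 1) / fact k)"
  \<comment> \<open>Beyond N the factor \<nu> + k + 1 has modulus at least 2 |q|^2 + 1. It is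
    therefore nonzero, so the functional equation can be divided by it, and it halves the
    terms.\<close>
  obtain N :: nat where N: "norm \<nu> + 2 * (norm q)\<^sup>2 + 1 < real N"
    using reals_Archimedean2 by blast
  have "norm (t (Suc k)) \<le> 1 / 2 * norm (t k)" if "k \<ge> N" for k
  proof -
    let ?w = "\<nu> + of_nat k + 1"
    have "norm (of_nat k + 1 :: complex) = real k + 1"
      by (metis norm_of_nat of_nat_Suc add.commute)
    then have w: "norm ?w \<ge> 2 * (norm q)\<^sup>2 + 1"
      using N that norm_triangle_ineq2[of "of_nat k + 1" "- \<nu>"] by (simp add: algebra_simps)
    then have w0: "?w \<noteq> 0"
      by (smt (verit) norm_zero zero_le_power2)
    have r: "rGamma (?w + 1) = rGamma ?w / ?w"
      using rGamma_plus1[of ?w] w0 by (simp add: field_simps)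
    have "\<nu> + of_nat (Suc k) + 1 = ?w + 1" "q ^ (2 * Suc k) = q ^ (2 * k) * q\<^sup>2"
      by (simp_all add: power2_eq_square)
    moreover have "A * Q * (G / W) / (S * F) = A * G / F * (Q / (W * S))" for A Q G W S F :: complex
      by (simp add: mult_ac)
    ultimately have "t (Suc k) = t k * (q\<^sup>2 / (?w * of_nat (Suc k)))"
      by (simp only: t_def r fact_Suc of_nat_mult)
    then have "norm (t (Suc k)) = norm (t k) * ((norm q)\<^sup>2 / (norm ?w * real (Suc k)))"
      by (simp only: norm_mult norm_divide norm_power norm_of_nat)
    also have "\<dots> \<le> norm (t k) * (1 / 2)"
    proof (intro mult_left_mono)
      have "2 * (norm q)\<^sup>2 * 1 \<le> norm ?w * real (Suc k)"
        using w by (intro mult_mono) auto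
      moreover have "norm ?w * real (Suc k) > 0" using w0 by simp
      ultimately show "(norm q)\<^sup>2 / (norm ?w * real (Suc k)) \<le> 1 / 2"
        by (simp add: divide_simps)
    qed auto
    finally show ?thesis by (simp add: mult.commute)
  qed
  then show ?thesis
    using summable_ratio_test[of "1/2" N t] by (simp add: t_def)
qed

text \<open>By the functional equation, (\<nu> + k) times the reciprocal Gamma value of order \<nu>
  is that of order \<nu> - 1. The part with \<nu> is the series of order \<nu>; the part with k,
  after an index shift, is q^2 times the series of order \<nu> + 1.\<close>

lemma bessel_I_recurrence:
  assumes "z \<noteq> 0"
  shows "bessel_I (\<nu> - 1) z - bessel_I (\<nu> + 1) z = 2 * \<nu> / z * bessel_I \<nu> z"
proof -
  define q where "q = z / 2"
  have q: "q \<noteq> 0" and z: "z = 2 * q"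
    using assms by (auto simp: q_def)
  define S where "S = (\<lambda>\<mu>. \<Sum>k. q ^ (2 * k) * rGamma (\<mu> + of_nat k + 1) / fact k)"
  have "(\<lambda>k. q ^ (2 * k) * rGamma (\<mu> + of_nat k + 1) / fact k) sums S \<mu>" for \<mu>
    unfolding S_def using bessel_series_summable by (rule summable_sums)
  note sums = this
  have "(\<lambda>k. q ^ (2 * Suc k) * rGamma (\<nu> + of_nat (Suc k) + 1) / fact k) sums (q\<^sup>2 * S (\<nu> + 1))"
    using sums_mult[OF sums[of "\<nu> + 1"], of "q\<^sup>2"]
    by (simp add: add_ac power_add power2_eq_square mult_ac)
  \<comment> \<open>Trading k! for (k + 1)! / (k + 1) exhibits the series as the tail of one
    weighted by k, whose term at k = 0 vanishes.\<close>
  then have "(\<lambda>k. of_nat (Suc k) * (q ^ (2 * Suc k) * rGamma (\<nu> + of_nat (Suc k) + 1) / fact (Suc k)))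
      sums (q\<^sup>2 * S (\<nu> + 1))"
    by (simp add: field_simps del: of_nat_Suc)
  then have "(\<lambda>k. of_nat k * (q ^ (2 * k) * rGamma (\<nu> + of_nat k + 1) / fact k))
      sums (q\<^sup>2 * S (\<nu> + 1))"
    by (subst (asm) sums_Suc_iff) simp
  from sums_add[OF sums_mult[OF sums[of \<nu>], of \<nu>] this]
  have "(\<lambda>k. (\<nu> + of_nat k) * rGamma (\<nu> + of_nat k + 1) * q ^ (2 * k) / fact k)
      sums (\<nu> * S \<nu> + q\<^sup>2 * S (\<nu> + 1))"
    by (simp add: algebra_simps add_divide_distrib)
  moreover have "(\<nu> + of_nat k) * rGamma (\<nu> + of_nat k + 1) * q ^ (2 * k) / fact k
      = q ^ (2 * k) * rGamma (\<nu> - 1 + of_nat k + 1) / fact k" for k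
    by (simp add: rGamma_plus1)
  ultimately have S: "S (\<nu> - 1) = \<nu> * S \<nu> + q\<^sup>2 * S (\<nu> + 1)"
    using sums[of "\<nu> - 1"] sums_unique2 by force
  have "q powr (\<nu> - 1) = q powr \<nu> / q" "q powr (\<nu> + 1) = q powr \<nu> * q"
    using q by (simp_all add: powr_diff powr_add)
  moreover have "bessel_I \<mu> z = q powr \<mu> * S \<mu>" for \<mu>
    by (simp add: bessel_I_def q_def S_def)
  moreover have "P / q * (\<nu> * A + q\<^sup>2 * B) - P * q * B = 2 * \<nu> / (2 * q) * (P * A)" for P A B
    using q by (simp add: divide_simps) (simp add: algebra_simps power2_eq_square)
  ultimately show ?thesis
    by (simp only: S z)
qed

text \<open>An instance of the duplication formula. It turns the Bessel series of order 1/2 into the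
  odd part of the exponential series.\<close>

lemma rGamma_three_halves_plus_nat:
  "rGamma (3 / 2 + of_nat k :: complex) / fact k = 2 ^ (2 * k + 1) / (of_real (sqrt pi) * fact (2 * k + 1))"
proof (induction k)
  case 0
  have "rGamma (3 / 2 :: complex) = 2 / of_real (sqrt pi)"
    using rGamma_plus1[of "1 / 2 :: complex"]
    by (simp add: rGamma_inverse_Gamma[of "1 / 2"] Gamma_one_half_complex field_simps)
  then show ?case by simp
next
  case (Suc k)
  let ?w = "3 / 2 + of_nat k :: complex"
  have w: "?w \<noteq> 0"
    by (auto simp: complex_eq_iff)
  have r: "rGamma (3 / 2 + of_nat (Suc k) :: complex) = rGamma ?w / ?w"
    using rGamma_plus1[of ?w] w by (simp add: field_simps add_ac)
  have "rGamma (3 / 2 + of_nat (Suc k) :: complex) / fact (Suc k)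
      = rGamma ?w / fact k / (?w * of_nat (Suc k))"
    by (simp add: r del: of_nat_Suc)
  also have "\<dots> = 2 ^ (2 * k + 1) / (of_real (sqrt pi) * fact (2 * k + 1)) / (?w * of_nat (Suc k))"
    by (simp only: Suc)
  also have "?w * of_nat (Suc k) = of_nat (2 * k + 3) * of_nat (2 * k + 2) / 4"
    by (simp add: field_simps)
  also have "2 ^ (2 * k + 1) / (of_real (sqrt pi) * fact (2 * k + 1)) / (of_nat (2 * k + 3) * of_nat (2 * k + 2) / 4)
    = 2 ^ (2 * Suc k + 1) / (of_real (sqrt pi) * (of_nat (2 * k + 3) * (of_nat (2 * k + 2) * fact (2 * k + 1))) :: complex)"
    by (simp add: mult_ac)
  also have "of_nat (2 * k + 3) * (of_nat (2 * k + 2) * fact (2 * k + 1)) = (fact (2 * Suc k + 1) :: complex)"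
    by (simp add: numeral_3_eq_3 algebra_simps)
  finally show ?case .
qed

text \<open>The exponent -1/2 in the prefactor is chosen to agree with order -1/2, so that the
  difference of the two functions collapses to cosh z - sinh z = exp (-z).\<close>

lemma bessel_I_half:
  assumes "z \<noteq> 0"
  shows "bessel_I (1 / 2) z = (z / 2) powr (- 1 / 2) * sinh z / of_real (sqrt pi)"
proof -
  define q where "q = z / 2"
  have q: "q \<noteq> 0" and z: "z = 2 * q"
    using assms by (auto simp: q_def)
  have "(\<lambda>n. if even n then 0 else z ^ n /\<^sub>R fact n) sums sinh z"
    by (rule sinh_converges)
  then have "(\<lambda>k. z ^ (2 * k + 1) /\<^sub>R fact (2 * k + 1)) sums sinh z"
    by (subst (asm) sums_mono_reindex[of "\<lambda>k. 2 * k + 1", symmetric])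
       (auto simp: strict_mono_def elim!: oddE)
  from sums_divide[OF this, of "of_real (sqrt pi) * q"]
  have "(\<lambda>k. q ^ (2 * k) * rGamma (1 / 2 + of_nat k + 1) / fact k) sums (sinh z / (of_real (sqrt pi) * q))"
  proof (rule sums_cong[THEN iffD1, rotated])
    fix k
    have "q ^ (2 * k) * rGamma (1 / 2 + of_nat k + 1) / fact k
      = q ^ (2 * k) * (rGamma (3 / 2 + of_nat k) / fact k)"
      by (simp add: add_ac)
    also have "\<dots> = z ^ (2 * k + 1) /\<^sub>R fact (2 * k + 1) / (of_real (sqrt pi) * q)"
      unfolding rGamma_three_halves_plus_nat using q
      by (simp add: z power_mult_distrib scaleR_conv_of_real divide_simps)
    finally show "z ^ (2 * k + 1) /\<^sub>R fact (2 * k + 1) / (of_real (sqrt pi) * q) 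
       = q ^ (2 * k) * rGamma (1 / 2 + of_nat k + 1) / fact k" ..
  qed
  then have "bessel_I (1 / 2) z = q powr (1 / 2) * (sinh z / (of_real (sqrt pi) * q))"
    by (simp add: bessel_I_def sums_iff flip: q_def)
  also have "q powr (1 / 2) = q powr (- 1 / 2) * q"
    using powr_add[of q "- 1 / 2" 1] q by simp
  finally show ?thesis using q by (simp flip: q_def)
qed

lemma rGamma_half_plus_nat:
  "rGamma (1 / 2 + of_nat k :: complex) / fact k = 2 ^ (2 * k) / (of_real (sqrt pi) * fact (2 * k))"
proof -
  have "rGamma (1 / 2 + of_nat k :: complex) = (1 / 2 + of_nat k) * rGamma (3 / 2 + of_nat k)"
    using rGamma_plus1[of "1 / 2 + of_nat k :: complex"] by (simp add: add_ac)
  then have "rGamma (1 / 2 + of_nat k :: complex) / fact k = of_nat (2 * k + 1) / 2 * (rGamma (3 / 2 + of_nat k) / fact k)"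
    by (simp add: field_simps)
  also have "\<dots> = 2 ^ (2 * k) / (of_real (sqrt pi) * (fact (2 * k + 1) / of_nat (2 * k + 1)))"
    unfolding rGamma_three_halves_plus_nat by (simp add: divide_simps del: fact_Suc)
  also have "(fact (2 * k + 1) / of_nat (2 * k + 1)) = (fact (2 * k) :: complex)"
    using of_nat_neq_0[of "2 * k", where ?'a = complex]
    by (simp add: divide_simps del: of_nat_mult of_nat_Suc)
  finally show ?thesis .
qed

lemma bessel_I_minus_half:
  "bessel_I (- 1 / 2) z = (z / 2) powr (- 1 / 2) * cosh z / of_real (sqrt pi)"
proof -
  have "(\<lambda>n. if even n then z ^ n /\<^sub>R fact n else 0) sums cosh z"
    by (rule cosh_converges)
  then have "(\<lambda>k. z ^ (2 * k) /\<^sub>R fact (2 * k)) sums cosh z"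
    by (subst (asm) sums_mono_reindex[of "\<lambda>k. 2 * k", symmetric])
       (auto simp: strict_mono_def elim!: evenE)
  from sums_divide[OF this, of "of_real (sqrt pi)"]
  have "(\<lambda>k. (z / 2) ^ (2 * k) * rGamma (- 1 / 2 + of_nat k + 1) / fact k) sums (cosh z / of_real (sqrt pi))"
  proof (rule sums_cong[THEN iffD1, rotated])
    fix k
    have "(z / 2) ^ (2 * k) * rGamma (- 1 / 2 + of_nat k + 1) / fact k
      = (z / 2) ^ (2 * k) * (rGamma (1 / 2 + of_nat k) / fact k)"
      by (simp add: add_ac)
    also have "\<dots> = z ^ (2 * k) /\<^sub>R fact (2 * k) / of_real (sqrt pi)"
      unfolding rGamma_half_plus_nat
      by (simp add: power_divide scaleR_conv_of_real divide_simps)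
    finally show "z ^ (2 * k) /\<^sub>R fact (2 * k) / of_real (sqrt pi)
       = (z / 2) ^ (2 * k) * rGamma (- 1 / 2 + of_nat k + 1) / fact k" ..
  qed
  then show ?thesis
    by (simp add: bessel_I_def sums_iff)
qed

lemma half_integer_not_Ints: "of_nat n + 1 / 2 \<notin> (\<int> :: complex set)"
proof
  assume "of_nat n + 1 / 2 \<in> (\<int> :: complex set)"
  then obtain i :: int where "of_nat n + 1 / 2 = (of_int i :: complex)"
    by (auto elim: Ints_cases)
  then have "of_int (2 * int n + 1) = (of_int (2 * i) :: complex)"
    by (simp add: field_simps)
  then have "2 * int n + 1 = 2 * i"
    by (simp only: of_int_eq_iff)
  then show False by presburger
qed

lemma sin_half_integer: "sin ((of_nat n + 1 / 2) * complex_of_real pi) = (- 1) ^ n"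
proof -
  have "sin ((of_nat n + 1 / 2) * complex_of_real pi) = complex_of_real (sin ((real n + 1 / 2) * pi))"
    by (simp flip: sin_of_real)
  also have "sin ((real n + 1 / 2) * pi) = cos (real n * pi)"
    using sin_cos_eq[of "(real n + 1 / 2) * pi"] by (simp add: algebra_simps)
  finally show ?thesis by simp
qed

text \<open>The sine in the denominator is (-1)^n, which is its own inverse.\<close>

lemma macdonald_K_half_integer:
  "macdonald_K (of_nat n + 1 / 2) z
     = of_real pi / 2 * (bessel_I (- (of_nat n + 1 / 2)) z - bessel_I (of_nat n + 1 / 2) z) * (- 1) ^ n"
  unfolding macdonald_K_def Let_def if_not_P[OF half_integer_not_Ints] sin_half_integer
  by (cases "even n") auto

lemma macdonald_K_half:
  assumes "z \<noteq> 0"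
  shows "macdonald_K (1 / 2) z = of_real (sqrt pi) / 2 * (z / 2) powr (- 1 / 2) * exp (- z)"
proof -
  have "macdonald_K (1 / 2) z = of_real pi / 2 * ((z / 2) powr (- 1 / 2) * (cosh z - sinh z) / of_real (sqrt pi))"
    using macdonald_K_half_integer[of 0 z] bessel_I_minus_half[of z] bessel_I_half[OF assms]
    by (simp add: diff_divide_distrib right_diff_distrib)
  also have "complex_of_real pi = of_real (sqrt pi) * of_real (sqrt pi)"
    by (simp flip: of_real_mult)
  finally show ?thesis by (simp add: cosh_minus_sinh)
qed

text \<open>The second starting value: the recurrence over natural n first reaches order 5/2. At
  order 1/2 it would involve order -1/2, and the recurrences of \<open>bessel_I\<close> at 1/2 and
  -1/2 lead back to the same two functions.\<close>

lemma macdonald_K_three_halves: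
  assumes "z \<noteq> 0"
  shows "macdonald_K (3 / 2) z = (1 + 1 / z) * macdonald_K (1 / 2) z"
proof -
  have "bessel_I (3 / 2) z = bessel_I (- 1 / 2) z - 1 / z * bessel_I (1 / 2) z"
    using bessel_I_recurrence[OF assms, of "1 / 2"] by (simp add: algebra_simps)
  moreover have "bessel_I (- 3 / 2) z = bessel_I (1 / 2) z - 1 / z * bessel_I (- 1 / 2) z"
    using bessel_I_recurrence[OF assms, of "- 1 / 2"] by (simp add: algebra_simps)
  moreover have "macdonald_K (3 / 2) z = of_real pi / 2 * (bessel_I (3 / 2) z - bessel_I (- 3 / 2) z)"
    using macdonald_K_half_integer[of 1 z] by (simp add: algebra_simps)
  moreover have "macdonald_K (1 / 2) z = of_real pi / 2 * (bessel_I (- 1 / 2) z - bessel_I (1 / 2) z)"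
    using macdonald_K_half_integer[of 0 z] by simp
  moreover have "P * ((A - w * B) - (B - w * A)) = (1 + w) * (P * (A - B))" for P A B w :: complex
    by algebra
  ultimately show ?thesis
    by (simp only:)
qed

text \<open>The functions of order \<nu> and -\<nu> step to order \<plusminus>(\<nu> + 1) with the
  same coefficient -c. The alternating sign from the sine turns -c into +c for K.\<close>

lemma macdonald_K_recurrence:
  assumes "z \<noteq> 0"
  shows "macdonald_K (of_nat (n + 2) + 1 / 2) z =
     macdonald_K (of_nat n + 1 / 2) z + of_nat (2 * n + 3) / z * macdonald_K (of_nat (n + 1) + 1 / 2) z"
proof -
  define \<nu> where "\<nu> = (of_nat (n + 1) + 1 / 2 :: complex)"
  define c where "c = 2 * \<nu> / z"
  have 1: "bessel_I (\<nu> + 1) z = bessel_I (\<nu> - 1) z - c * bessel_I \<nu> z"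
    using bessel_I_recurrence[OF assms, of \<nu>] by (simp add: c_def algebra_simps)
  have "- \<nu> - 1 = - (\<nu> + 1)" "- \<nu> + 1 = - (\<nu> - 1)" "2 * (- \<nu>) / z = - c"
    by (simp_all add: c_def)
  then have 2: "bessel_I (- (\<nu> + 1)) z = bessel_I (- (\<nu> - 1)) z - c * bessel_I (- \<nu>) z"
    using bessel_I_recurrence[OF assms, of "- \<nu>"] by (simp only:) (simp add: algebra_simps)
  have \<nu>: "of_nat (n + 1) + 1 / 2 = \<nu>" "of_nat (n + 2) + 1 / 2 = \<nu> + 1" "of_nat n + 1 / 2 = \<nu> - 1"
    by (simp_all add: \<nu>_def)
  have "of_nat (2 * n + 3) / z = c"
    by (simp add: c_def \<nu>_def)
  then have "of_nat (2 * n + 3) / z * macdonald_K \<nu> z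
      = c * (of_real pi / 2 * (bessel_I (- \<nu>) z - bessel_I \<nu> z) * - ((- 1) ^ n))"
    using macdonald_K_half_integer[of "n + 1" z] unfolding \<nu> by simp
  moreover have "macdonald_K (\<nu> + 1) z = of_real pi / 2 * ((bessel_I (- (\<nu> - 1)) z - c * bessel_I (- \<nu>) z)
      - (bessel_I (\<nu> - 1) z - c * bessel_I \<nu> z)) * (- 1) ^ n"
    using macdonald_K_half_integer[of "n + 2" z] unfolding \<nu> 1 2 by simp
  moreover have "macdonald_K (\<nu> - 1) z
      = of_real pi / 2 * (bessel_I (- (\<nu> - 1)) z - bessel_I (\<nu> - 1) z) * (- 1) ^ n"
    using macdonald_K_half_integer[of n z] unfolding \<nu> .
  moreover have "P * ((D - c * A) - (C - c * B)) * s = P * (D - C) * s + c * (P * (A - B) * - s)"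
    for A B C D P s :: complex
    by algebra
  ultimately show ?thesis
    unfolding \<nu> by (simp only:)
qed

text \<open>The \<open>p n\<close> are the Bessel polynomials in 1/z: with p_0 = 1 they satisfy
  p_{n+2} = p_n + (2n+3)/z p_{n+1}, the recurrence of K.\<close>

lemma macdonald_K_half_integer_closed_form:
  assumes "z \<noteq> 0" and "n \<in> {1..4}"
  shows "macdonald_K (of_nat n + 1 / 2) z = of_real (sqrt pi) / 2 * (z / 2) powr (- 1 / 2) * p n z * exp (- z)"
proof -
  define k where "k = macdonald_K (1 / 2) z"
  have 1: "macdonald_K (3 / 2) z = p 1 z * k"
    using macdonald_K_three_halves[OF assms(1)] by (simp add: k_def p_def add.commute)
  have "macdonald_K (5 / 2) z = k + 3 / z * (p 1 z * k)"
    using macdonald_K_recurrence[OF assms(1), of 0] 1 by (simp add: k_def)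
  also have "\<dots> = p 2 z * k"
    using assms(1) by (simp add: p_def) (simp add: field_simps power2_eq_square)
  finally have 2: "macdonald_K (5 / 2) z = p 2 z * k" .
  have "macdonald_K (7 / 2) z = p 1 z * k + 5 / z * (p 2 z * k)"
    using macdonald_K_recurrence[OF assms(1), of 1] 1 2 by simp
  also have "\<dots> = p 3 z * k"
    using assms(1) by (simp add: p_def) (simp add: field_simps power2_eq_square power3_eq_cube)
  finally have 3: "macdonald_K (7 / 2) z = p 3 z * k" .
  have "macdonald_K (9 / 2) z = p 2 z * k + 7 / z * (p 3 z * k)"
    using macdonald_K_recurrence[OF assms(1), of 2] 2 3 by simp
  also have "\<dots> = p 4 z * k"
    using assms(1) by (simp add: p_def) (simp add: field_simps power2_eq_square power3_eq_cube power4_eq_xxxx)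
  finally have 4: "macdonald_K (9 / 2) z = p 4 z * k" .
  have "n = 1 \<or> n = 2 \<or> n = 3 \<or> n = 4" using assms(2) by auto
  then have "macdonald_K (of_nat n + 1 / 2) z = p n z * k"
    using 1 2 3 4 by auto
  then show ?thesis by (simp add: k_def macdonald_K_half assms(1) mult_ac)
qed

section \<open>The Mellin--Barnes loop integral\<close>

text \<open>Real parameters put all poles on the real axis and give the loop of
  \<open>meijer_G2002_log\<close> the half-height 1.\<close>

definition mellin_barnes_integrand :: "real \<Rightarrow> real \<Rightarrow> complex \<Rightarrow> complex \<Rightarrow> complex" where
  "mellin_barnes_integrand b1 b2 L s = Gamma (of_real b1 - s) * Gamma (of_real b2 - s) * exp (s * L)"

lemma mellin_barnes_integrand_commute:
  "mellin_barnes_integrand b1 b2 = mellin_barnes_integrand b2 b1"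
  by (simp add: mellin_barnes_integrand_def fun_eq_iff)

text \<open>The residue at \<open>b1 + k\<close> with the sign reversed, because the loop runs clockwise.\<close>

definition residue_term :: "real \<Rightarrow> real \<Rightarrow> complex \<Rightarrow> nat \<Rightarrow> complex" where
  "residue_term b1 b2 L k =
     (- 1) ^ k / fact k * Gamma (of_real b2 - of_real b1 - of_nat k) * exp ((of_real b1 + of_nat k) * L)"

lemma diff_in_nonpos_Ints_iff:
  "of_real b - s \<in> \<int>\<^sub>\<le>\<^sub>0 \<longleftrightarrow> (\<exists>k. s = of_real b + of_nat k)" for s :: complex
proof
  assume "of_real b - s \<in> \<int>\<^sub>\<le>\<^sub>0"
  then obtain k where "of_real b - s = - of_nat k"
    by (elim nonpos_Ints_cases')
  then have "s = of_real b + of_nat k"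
    by (simp add: algebra_simps)
  then show "\<exists>k. s = of_real b + of_nat k" ..
qed auto

definition is_mellin_barnes_pole :: "real \<Rightarrow> real \<Rightarrow> complex \<Rightarrow> bool" where
  "is_mellin_barnes_pole b1 b2 s \<longleftrightarrow> (\<exists>k. s = of_real b1 + of_nat k) \<or> (\<exists>k. s = of_real b2 + of_nat k)"

lemma holomorphic_mellin_barnes:
  assumes "\<And>s. s \<in> A \<Longrightarrow> \<not> is_mellin_barnes_pole b1 b2 s"
  shows "mellin_barnes_integrand b1 b2 L holomorphic_on A"
  unfolding mellin_barnes_integrand_def
  using assms by (auto intro!: holomorphic_intros simp: diff_in_nonpos_Ints_iff is_mellin_barnes_pole_def)

lemma continuous_on_mellin_barnes:
  assumes "\<And>s. s \<in> A \<Longrightarrow> \<not> is_mellin_barnes_pole b1 b2 s"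
  shows "continuous_on A (mellin_barnes_integrand b1 b2 L)"
  using holomorphic_mellin_barnes[OF assms] by (rule holomorphic_on_imp_continuous_on)

text \<open>Writing the first Gamma factor as 1 / \<open>rGamma\<close> exhibits a simple zero of an
  entire function in the denominator, with known derivative. The other Gamma factor is holomorphic
  nearby because the pole families do not meet.\<close>

lemma residue_mellin_barnes:
  assumes "b1 - b2 \<notin> \<int>"
  shows "residue (mellin_barnes_integrand b1 b2 L) (of_real b1 + of_nat k) = - residue_term b1 b2 L k"
proof -
  let ?z = "complex_of_real b1 + of_nat k"
  have "of_real b2 - ?z \<notin> \<int>\<^sub>\<le>\<^sub>0"
  proof
    assume "of_real b2 - ?z \<in> \<int>\<^sub>\<le>\<^sub>0"
    then obtain j where "?z = of_real b2 + of_nat j"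
      by (auto simp: diff_in_nonpos_Ints_iff)
    then have "b1 - b2 = real j - real k"
      by (auto simp: complex_eq_iff)
    then show False using assms by auto
  qed
  then obtain d where d: "d > 0" "\<And>t. t \<in> ball (of_real b2 - ?z) d \<Longrightarrow> t \<notin> \<int>\<^sub>\<le>\<^sub>0"
    by (rule no_nonpos_Int_in_ball') blast
  have ball: "of_real b2 - s \<notin> \<int>\<^sub>\<le>\<^sub>0" if "s \<in> ball ?z d" for s
  proof (rule d(2))
    have "(of_real b2 - ?z) - (of_real b2 - s) = - (?z - s)" by simp
    then show "of_real b2 - s \<in> ball (of_real b2 - ?z) d"
      using that by (simp only: mem_ball dist_norm norm_minus_cancel)
  qed
  have deriv: "((\<lambda>s. rGamma (of_real b1 - s)) has_field_derivative - ((- 1) ^ k * fact k)) (at ?z)"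
  proof -
    have "((\<lambda>s. of_real b1 - s) has_field_derivative - 1) (at ?z)"
      by (auto intro!: derivative_eq_intros)
    moreover have "(rGamma has_field_derivative (- 1) ^ k * fact k) (at (of_real b1 - ?z))"
      using has_field_derivative_rGamma_nonpos_int[of k] by simp
    ultimately show ?thesis
      using DERIV_chain2 by fastforce
  qed
  have "residue (\<lambda>s. (Gamma (of_real b2 - s) * exp (s * L)) / rGamma (of_real b1 - s)) ?z
      = (Gamma (of_real b2 - ?z) * exp (?z * L)) / - ((- 1) ^ k * fact k)"
  proof (rule residue_simple_pole_deriv[where s = "ball ?z d"])
    show "Gamma (of_real b2 - ?z) * exp (?z * L) \<noteq> 0"
      using ball[of ?z] d(1) by (simp add: Gamma_eq_zero_iff)
    show "rGamma (of_real b1 - ?z) = 0"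
      by (simp add: rGamma_eq_zero_iff)
  qed (use d(1) ball deriv in \<open>auto intro!: holomorphic_intros\<close>)
  moreover have "(\<lambda>s. (Gamma (of_real b2 - s) * exp (s * L)) / rGamma (of_real b1 - s)) = mellin_barnes_integrand b1 b2 L"
    by (simp add: fun_eq_iff mellin_barnes_integrand_def Gamma_def divide_inverse)
  ultimately have "residue (mellin_barnes_integrand b1 b2 L) ?z
      = (Gamma (of_real b2 - of_real b1 - of_nat k) * exp (?z * L)) / - ((- 1) ^ k * fact k)"
    by (simp only: diff_diff_eq)
  then show ?thesis
    unfolding residue_term_def by (cases "even k") simp_all
qed

text \<open>The bounds on R place exactly N1 and N2 poles of the two families left of the right
  edge. The rectangle runs counterclockwise while \<open>residue_term\<close> carries the clockwise
  sign, hence the minus.\<close>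

lemma contour_integral_rectpath_mellin_barnes:
  assumes diff: "b1 - b2 \<notin> \<int>" and "\<tau> > 0" and \<sigma>: "\<sigma> < b1" "\<sigma> < b2"
    and R: "R \<in> {b1 + real N1 - 1<..<b1 + real N1}" "R \<in> {b2 + real N2 - 1<..<b2 + real N2}" "\<sigma> < R"
  shows "contour_integral (rectpath (Complex \<sigma> (- \<tau>)) (Complex R \<tau>)) (mellin_barnes_integrand b1 b2 L)
     = - (2 * of_real pi * \<i>) * ((\<Sum>k<N1. residue_term b1 b2 L k) + (\<Sum>k<N2. residue_term b2 b1 L k))"
proof -
  define P1 where "P1 = (\<lambda>k. complex_of_real b1 + of_nat k) ` {..<N1}"
  define P2 where "P2 = (\<lambda>k. complex_of_real b2 + of_nat k) ` {..<N2}"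
  \<comment> \<open>The half-plane ends before the first poles beyond the rectangle, so the residue
    theorem meets only finitely many singularities.\<close>
  define S where "S = {s. Re s < min (b1 + real N1) (b2 + real N2)}"
  let ?f = "mellin_barnes_integrand b1 b2 L"
  let ?g = "rectpath (Complex \<sigma> (- \<tau>)) (Complex R \<tau>)"
  have disj: "P1 \<inter> P2 = {}"
  proof -
    have False if "complex_of_real b1 + of_nat k = of_real b2 + of_nat j" for k j
    proof -
      have "b1 - b2 = real j - real k"
        using that by (auto simp: complex_eq_iff)
      then show False using diff by auto
    qed
    then show ?thesis by (force simp: P1_def P2_def)
  qed
  have box: "P1 \<union> P2 \<subseteq> box (Complex \<sigma> (- \<tau>)) (Complex R \<tau>)"
    using assms by (auto simp: P1_def P2_def in_box_complex_iff)
  have img: "path_image ?g = cbox (Complex \<sigma> (- \<tau>)) (Complex R \<tau>) - box (Complex \<sigma> (- \<tau>)) (Complex R \<tau>)"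
    using assms by (intro path_image_rectpath_cbox_minus_box) auto
  have cS: "cbox (Complex \<sigma> (- \<tau>)) (Complex R \<tau>) \<subseteq> S"
    using R by (auto simp: S_def in_cbox_complex_iff)
  have convS: "convex S" "open S"
    unfolding S_def by (rule convex_halfspace_Re_lt, rule open_halfspace_Re_lt)
  have poles: "\<not> is_mellin_barnes_pole b1 b2 s" if "s \<in> S - (P1 \<union> P2)" for s
    using that by (auto simp: is_mellin_barnes_pole_def S_def P1_def P2_def)
  have "contour_integral ?g ?f = 2 * pi * \<i> * (\<Sum>p\<in>P1 \<union> P2. winding_number ?g p * residue ?f p)"
  proof (rule Residue_theorem)
    show "open S" "connected S" "finite (P1 \<union> P2)"
      using convS by (auto simp: convex_connected P1_def P2_def)
    show "?f holomorphic_on S - (P1 \<union> P2)"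
      using poles by (rule holomorphic_mellin_barnes)
    show "path_image ?g \<subseteq> S - (P1 \<union> P2)"
      using img box cS by auto
    show "\<forall>z. z \<notin> S \<longrightarrow> winding_number ?g z = 0"
    proof (intro allI impI)
      fix z assume "z \<notin> S"
      then show "winding_number ?g z = 0"
        using img cS convS by (intro winding_number_zero_outside[of _ S]) auto
    qed
  qed auto
  also have "(\<Sum>p\<in>P1 \<union> P2. winding_number ?g p * residue ?f p) = (\<Sum>p\<in>P1 \<union> P2. residue ?f p)"
  proof (intro sum.cong refl)
    fix p assume "p \<in> P1 \<union> P2"
    then have "winding_number ?g p = 1"
      using box by (intro winding_number_rectpath) auto
    then show "winding_number ?g p * residue ?f p = residue ?f p" by simp
  qed
  also have "\<dots> = (\<Sum>p\<in>P1. residue ?f p) + (\<Sum>p\<in>P2. residue ?f p)"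
    using disj by (intro sum.union_disjoint) (auto simp: P1_def P2_def)
  also have "(\<Sum>p\<in>P1. residue ?f p) = (\<Sum>k<N1. - residue_term b1 b2 L k)"
    unfolding P1_def by (subst sum.reindex) (auto simp: inj_on_def residue_mellin_barnes[OF diff])
  also have "(\<Sum>p\<in>P2. residue ?f p) = (\<Sum>k<N2. - residue_term b2 b1 L k)"
  proof -
    have "b2 - b1 \<notin> \<int>"
      using diff Ints_minus[of "b2 - b1"] by auto
    from residue_mellin_barnes[OF this] show ?thesis
      unfolding P2_def mellin_barnes_integrand_commute[of b1]
      by (subst sum.reindex) (auto simp: inj_on_def)
  qed
  finally show ?thesis by (simp add: sum_negf algebra_simps)
qed

section \<open>Decay of the integrand to the right\<close>

lemma mellin_barnes_shift:
  assumes "of_real b1 - s - 1 \<noteq> 0" "of_real b2 - s - 1 \<noteq> 0"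
  shows "mellin_barnes_integrand b1 b2 L (s + 1)
    = mellin_barnes_integrand b1 b2 L s * exp L / ((of_real b1 - s - 1) * (of_real b2 - s - 1))"
proof -
  \<comment> \<open>Arguing through \<open>rGamma\<close> covers the poles too: there both sides
    have the default value 0, and only w = 0 must be excluded.\<close>
  have Gamma: "Gamma (of_real b - s) = (of_real b - s - 1) * Gamma (of_real b - (s + 1))"
    if "of_real b - s - 1 \<noteq> 0" for b
  proof -
    define w where "w = of_real b - s - 1"
    have w: "w \<noteq> 0" "of_real b - s = w + 1" "of_real b - (s + 1) = w"
      using that by (simp_all add: w_def)
    have "Gamma w = inverse w * Gamma (w + 1)"
      using rGamma_plus1[of w] by (metis Gamma_def inverse_mult_distrib)
    then show ?thesis
      unfolding w using w(1) by simp
  qed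
  have "exp ((s + 1) * L) = exp (s * L) * exp L"
    by (simp add: ring_distribs exp_add)
  then show ?thesis
    using assms by (simp add: mellin_barnes_integrand_def Gamma)
qed

text \<open>Both linear factors in the denominator have modulus at least M: one outweighs 2 |exp L|,
  the other need only be at least 1.\<close>

lemma mellin_barnes_halved:
  assumes "M \<ge> 1" "2 * norm (exp L) \<le> M" and "Re s + 1 \<ge> b1 + M" "Re s + 1 \<ge> b2 + M"
  shows "norm (mellin_barnes_integrand b1 b2 L (s + 1)) \<le> norm (mellin_barnes_integrand b1 b2 L s) / 2"
proof -
  have *: "norm (of_real b - s - 1) \<ge> M" if "Re s + 1 \<ge> b + M" for b
    using that abs_Re_le_cmod[of "of_real b - s - 1"] by simp
  have le: "M * 1 \<le> norm (of_real b1 - s - 1) * norm (of_real b2 - s - 1)"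
    using *[OF assms(3)] *[OF assms(4)] assms(1) by (intro mult_mono) auto
  have "norm (mellin_barnes_integrand b1 b2 L (s + 1))
     = norm (mellin_barnes_integrand b1 b2 L s) * (norm (exp L) / (norm (of_real b1 - s - 1) * norm (of_real b2 - s - 1)))"
    using *[OF assms(3)] *[OF assms(4)] assms(1)
    by (subst mellin_barnes_shift) (auto simp: norm_mult norm_divide)
  also have "\<dots> \<le> norm (mellin_barnes_integrand b1 b2 L s) * (1 / 2)"
    using le assms(1,2) by (intro mult_left_mono) (auto simp: divide_simps)
  finally show ?thesis by simp
qed

lemma mellin_barnes_decay:
  assumes "M \<ge> 1" "2 * norm (exp L) \<le> M" and "Re s + 1 \<ge> b1 + M" "Re s + 1 \<ge> b2 + M"
  shows "norm (mellin_barnes_integrand b1 b2 L (s + of_nat k)) \<le> norm (mellin_barnes_integrand b1 b2 L s) / 2 ^ k"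
proof (induction k)
  case (Suc k)
  have "norm (mellin_barnes_integrand b1 b2 L (s + of_nat k + 1)) \<le> norm (mellin_barnes_integrand b1 b2 L (s + of_nat k)) / 2"
    using assms by (intro mellin_barnes_halved[of M]) auto
  with Suc show ?case by (simp add: add_ac)
qed simp

section \<open>Cutting and closing the loop\<close>

definition loop_integral :: "real \<Rightarrow> real \<Rightarrow> (complex \<Rightarrow> complex) \<Rightarrow> real \<Rightarrow> complex" where
  "loop_integral \<sigma> \<tau> f R = contour_integral
     (linepath (Complex R (- \<tau>)) (Complex \<sigma> (- \<tau>)) +++
      linepath (Complex \<sigma> (- \<tau>)) (Complex \<sigma> \<tau>) +++
      linepath (Complex \<sigma> \<tau>) (Complex R \<tau>)) f"

lemma closed_segment_vertical:
  assumes "s \<in> closed_segment (Complex r u) (Complex r v)"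
  shows "Re s = r" "Im s \<in> closed_segment u v"
  using assms closed_segment_same_Re[of "Complex r u" "Complex r v"] by auto

lemma closed_segment_horizontal:
  assumes "s \<in> closed_segment (Complex u t) (Complex v t)"
  shows "Im s = t" "Re s \<in> closed_segment u v"
  using assms closed_segment_same_Im[of "Complex u t" "Complex v t"] by auto

text \<open>The loop is the rectangle traversed backwards with its right edge left out.\<close>

lemma loop_integral_rectpath:
  assumes "\<sigma> < R"
    and cont: "continuous_on (path_image (rectpath (Complex \<sigma> (- \<tau>)) (Complex R \<tau>))) f"
  shows "loop_integral \<sigma> \<tau> f R =
     contour_integral (linepath (Complex R (- \<tau>)) (Complex R \<tau>)) f
     - contour_integral (rectpath (Complex \<sigma> (- \<tau>)) (Complex R \<tau>)) f"
proof -
  let ?A = "Complex \<sigma> (- \<tau>)" and ?B = "Complex R (- \<tau>)" and ?C = "Complex R \<tau>" and ?D = "Complex \<sigma> \<tau>"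
  have seg: "continuous_on (closed_segment ?A ?B) f" "continuous_on (closed_segment ?B ?C) f"
    "continuous_on (closed_segment ?C ?D) f" "continuous_on (closed_segment ?D ?A) f"
    using cont by (auto simp: rectpath_def Let_def path_image_join elim!: continuous_on_subset)
  then have seg': "continuous_on (closed_segment ?B ?A) f" "continuous_on (closed_segment ?A ?D) f"
    "continuous_on (closed_segment ?D ?C) f"
    by (metis closed_segment_commute)+
  have "loop_integral \<sigma> \<tau> f R = contour_integral (linepath ?B ?A) f +
      (contour_integral (linepath ?A ?D) f + contour_integral (linepath ?D ?C) f)"
    unfolding loop_integral_def using seg'
    by (simp add: contour_integrable_continuous_linepath)
  moreover have "contour_integral (rectpath ?A ?C) f = contour_integral (linepath ?A ?B) f +
      (contour_integral (linepath ?B ?C) f + (contour_integral (linepath ?C ?D) f + contour_integral (linepath ?D ?A) f))"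
    unfolding rectpath_def Let_def using seg
    by (simp add: contour_integrable_continuous_linepath)
  ultimately show ?thesis
    using contour_integral_reverse_linepath[OF seg(1)] contour_integral_reverse_linepath[OF seg(3)]
      contour_integral_reverse_linepath[OF seg(4)]
    by simp
qed

text \<open>Moving the right end changes only the two horizontal rays; this serves right ends whose
  vertical edge may hit a pole.\<close>

lemma loop_integral_extend:
  assumes "\<sigma> \<le> r" "r \<le> R"
    and cont: "continuous_on (closed_segment (Complex \<sigma> (- \<tau>)) (Complex R (- \<tau>))) f"
      "continuous_on (closed_segment (Complex \<sigma> \<tau>) (Complex R \<tau>)) f"
      "continuous_on (closed_segment (Complex \<sigma> (- \<tau>)) (Complex \<sigma> \<tau>)) f"
  shows "loop_integral \<sigma> \<tau> f R = loop_integral \<sigma> \<tau> f r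
     + contour_integral (linepath (Complex R (- \<tau>)) (Complex r (- \<tau>))) f
     + contour_integral (linepath (Complex r \<tau>) (Complex R \<tau>)) f"
proof -
  have mem: "Complex r t \<in> closed_segment (Complex \<sigma> t) (Complex R t)" for t
    using assms by (subst closed_segment_same_Im) (auto simp: closed_segment_eq_real_ivl)
  have rev: "continuous_on (closed_segment (Complex R (- \<tau>)) (Complex \<sigma> (- \<tau>))) f"
    using cont(1) by (metis closed_segment_commute)
  have sub: "closed_segment (Complex r (- \<tau>)) (Complex \<sigma> (- \<tau>)) \<subseteq> closed_segment (Complex R (- \<tau>)) (Complex \<sigma> (- \<tau>))"
    "closed_segment (Complex \<sigma> \<tau>) (Complex r \<tau>) \<subseteq> closed_segment (Complex \<sigma> \<tau>) (Complex R \<tau>)"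
    using mem[of "- \<tau>"] mem[of \<tau>] by (auto simp: subset_closed_segment closed_segment_commute)
  note int = contour_integrable_continuous_linepath
  have "loop_integral \<sigma> \<tau> f R = contour_integral (linepath (Complex R (- \<tau>)) (Complex \<sigma> (- \<tau>))) f +
      (contour_integral (linepath (Complex \<sigma> (- \<tau>)) (Complex \<sigma> \<tau>)) f + contour_integral (linepath (Complex \<sigma> \<tau>) (Complex R \<tau>)) f)"
    unfolding loop_integral_def using int[OF rev] int[OF cont(2)] int[OF cont(3)] by simp
  moreover have "loop_integral \<sigma> \<tau> f r = contour_integral (linepath (Complex r (- \<tau>)) (Complex \<sigma> (- \<tau>))) f +
      (contour_integral (linepath (Complex \<sigma> (- \<tau>)) (Complex \<sigma> \<tau>)) f + contour_integral (linepath (Complex \<sigma> \<tau>) (Complex r \<tau>)) f)"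
    unfolding loop_integral_def
    using int[OF continuous_on_subset[OF rev sub(1)]] int[OF continuous_on_subset[OF cont(2) sub(2)]] int[OF cont(3)] by simp
  moreover have "contour_integral (linepath (Complex R (- \<tau>)) (Complex \<sigma> (- \<tau>))) f =
      contour_integral (linepath (Complex R (- \<tau>)) (Complex r (- \<tau>))) f + contour_integral (linepath (Complex r (- \<tau>)) (Complex \<sigma> (- \<tau>))) f"
    using mem[of "- \<tau>"] by (intro contour_integral_split_linepath[OF rev]) (simp add: closed_segment_commute)
  moreover have "contour_integral (linepath (Complex \<sigma> \<tau>) (Complex R \<tau>)) f =
      contour_integral (linepath (Complex \<sigma> \<tau>) (Complex r \<tau>)) f + contour_integral (linepath (Complex r \<tau>) (Complex R \<tau>)) f"
    using mem[of \<tau>] by (intro contour_integral_split_linepath[OF cont(2)])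
  ultimately show ?thesis by simp
qed

section \<open>The limit of the loop integral\<close>

lemma half_integer_real_not_Ints: "real m + 1 / 2 \<notin> \<int>"
proof
  assume "real m + 1 / 2 \<in> \<int>"
  then obtain i where "real m + 1 / 2 = of_int i"
    by (elim Ints_cases)
  then have "real_of_int (2 * int m + 1) = real_of_int (2 * i)"
    by simp
  then have "2 * int m + 1 = 2 * i"
    by (simp only: of_int_eq_iff)
  then show False by presburger
qed

text \<open>For right ends r + k the loop is a partial sum of residues plus one vertical edge of
  length 2. Any other right end differs from the nearest r + k on its left by two horizontal pieces
  of length at most 1. Both errors are at most 2 B / 2^k.\<close>

lemma tendsto_loop_integral:
  fixes L :: complex
  assumes b1: "b1 = b2 + real m + 1 / 2"
    and sum1: "summable (residue_term b1 b2 L)" and sum2: "summable (residue_term b2 b1 L)"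
  shows "(loop_integral (b2 - 1) 1 (mellin_barnes_integrand b1 b2 L) \<longlongrightarrow>
     2 * of_real pi * \<i> * (suminf (residue_term b1 b2 L) + suminf (residue_term b2 b1 L))) at_top"
proof -
  let ?f = "mellin_barnes_integrand b1 b2 L"
  define T where "T = 2 * of_real pi * \<i> * (suminf (residue_term b1 b2 L) + suminf (residue_term b2 b1 L))"
  define J where "J = loop_integral (b2 - 1) 1 ?f"
  have diff: "b1 - b2 \<notin> \<int>"
    using half_integer_real_not_Ints[of m] by (simp add: b1)
  have no_pole: "\<not> is_mellin_barnes_pole b1 b2 s"
    if "\<bar>Im s\<bar> = 1 \<or> Re s < b2 \<or> (\<exists>N::nat. Re s = b1 + real N - 1 / 4)" for s
  proof -
    \<comment> \<open>Multiplied by 4, a pole on such an edge would make 1 or -1 divisible by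
      4.\<close>
    have False if "b1 + real k = b1 + real N - 1 / 4" for k N
    proof -
      have "real_of_int (4 * int k - 4 * int N) = real_of_int (- 1)" using that by simp
      then have "4 * int k - 4 * int N = - 1" by (simp only: of_int_eq_iff)
      then show False by presburger
    qed
    moreover have False if "b2 + real k = b1 + real N - 1 / 4" for k N
    proof -
      have "real_of_int (4 * int k - 4 * int N - 4 * int m) = real_of_int 1" using that by (simp add: b1)
      then have "4 * int k - 4 * int N - 4 * int m = 1" by (simp only: of_int_eq_iff)
      then show False by presburger
    qed
    ultimately show ?thesis
      using that by (auto simp: is_mellin_barnes_pole_def b1)
  qed
  obtain N :: nat where N: "2 * norm (exp L) + 1 \<le> real N"
    using real_arch_simple by blast
  define M where "M = 2 * norm (exp L) + 1"
  \<comment> \<open>The right edges \<open>Re s = r + k\<close> stay at distance \<open>1 / 4\<close> from both families of poles,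
    because \<open>b1 - b2\<close> is a half-integer.\<close>
  define r where "r = b1 + real N - 1 / 4"
  have M: "M \<ge> 1" "2 * norm (exp L) \<le> M" "r + 1 \<ge> b1 + M" "r + 1 \<ge> b2 + M"
    using N by (auto simp: M_def r_def b1)
  \<comment> \<open>Only the boundary, since poles lie inside. Every point of the later right edges,
    and of the horizontal rays beyond r, is a point of S shifted by a natural number.\<close>
  define S where "S = path_image (rectpath (Complex r (- 1)) (Complex (r + 1) 1))"
  have S: "S = {z. Re z \<in> {r, r + 1} \<and> Im z \<in> {- 1..1}} \<union> {z. Im z \<in> {- 1, 1} \<and> Re z \<in> {r..r + 1}}"
    unfolding S_def by (subst path_image_rectpath) auto
  have "\<not> is_mellin_barnes_pole b1 b2 s" if "s \<in> S" for s
  proof (rule no_pole)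
    have "r = b1 + real N - 1 / 4" "r + 1 = b1 + real (Suc N) - 1 / 4" by (simp_all add: r_def)
    moreover have "Re s = r \<or> Re s = r + 1 \<or> \<bar>Im s\<bar> = 1"
      using that unfolding S by auto
    ultimately show "\<bar>Im s\<bar> = 1 \<or> Re s < b2 \<or> (\<exists>N::nat. Re s = b1 + real N - 1 / 4)"
      by metis
  qed
  then have "continuous_on S ?f" by (rule continuous_on_mellin_barnes)
  moreover have "compact S"
    unfolding S_def by (intro compact_path_image) auto
  ultimately have "bounded (?f ` S)"
    by (intro compact_imp_bounded compact_continuous_image)
  then obtain B where B: "B > 0" "\<And>s. s \<in> S \<Longrightarrow> norm (?f s) \<le> B"
    unfolding bounded_pos by blast
  have decay: "norm (?f s) \<le> B / 2 ^ k" if "s - of_nat k \<in> S" for s k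
  proof -
    have "Re (s - of_nat k) \<ge> r" using that unfolding S by auto
    then have "norm (?f (s - of_nat k + of_nat k)) \<le> norm (?f (s - of_nat k)) / 2 ^ k"
      using M by (intro mellin_barnes_decay[of M]) auto
    also have "\<dots> \<le> B / 2 ^ k"
      using B(2)[OF that] by (intro divide_right_mono) auto
    finally show ?thesis by simp
  qed
  have lim0: "(\<lambda>k. C * (B / 2 ^ k)) \<longlonglongrightarrow> 0" for C
  proof -
    have "(\<lambda>k. C * B * (1 / 2) ^ k) \<longlonglongrightarrow> C * B * 0"
      by (intro tendsto_intros LIMSEQ_realpow_zero) auto
    then show ?thesis by (simp add: power_divide)
  qed
  have R: "b2 - 1 < r + real k" for k by (simp add: r_def b1)
  \<comment> \<open>The counts differ because r + k = b1 + (k + N) - 1/4 = b2 + (k + N + m) + 1/4: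
    the edge lies just before a pole of the first family and just after one of the second.\<close>
  have J_eq: "J (r + real k) = contour_integral (linepath (Complex (r + real k) (- 1)) (Complex (r + real k) 1)) ?f
      + 2 * of_real pi * \<i> * ((\<Sum>j<k + N. residue_term b1 b2 L j) + (\<Sum>j<k + (N + m + 1). residue_term b2 b1 L j))" for k
  proof -
    have "continuous_on (path_image (rectpath (Complex (b2 - 1) (- 1)) (Complex (r + real k) 1))) ?f"
    proof (intro continuous_on_mellin_barnes no_pole)
      fix s assume "s \<in> path_image (rectpath (Complex (b2 - 1) (- 1)) (Complex (r + real k) 1))"
      then have "\<bar>Im s\<bar> = 1 \<or> Re s < b2 \<or> Re s = r + real k"
        using R[of k] by (subst (asm) path_image_rectpath) auto
      moreover have "r + real k = b1 + real (N + k) - 1 / 4" by (simp add: r_def)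
      ultimately show "\<bar>Im s\<bar> = 1 \<or> Re s < b2 \<or> (\<exists>N::nat. Re s = b1 + real N - 1 / 4)"
        by metis
    qed
    then have "J (r + real k) = contour_integral (linepath (Complex (r + real k) (- 1)) (Complex (r + real k) 1)) ?f
       - contour_integral (rectpath (Complex (b2 - 1) (- 1)) (Complex (r + real k) 1)) ?f"
      unfolding J_def using R by (intro loop_integral_rectpath)
    also have "contour_integral (rectpath (Complex (b2 - 1) (- 1)) (Complex (r + real k) 1)) ?f =
       - (2 * of_real pi * \<i>) * ((\<Sum>j<k + N. residue_term b1 b2 L j) + (\<Sum>j<k + (N + m + 1). residue_term b2 b1 L j))"
      using diff R by (intro contour_integral_rectpath_mellin_barnes) (auto simp: r_def b1)
    finally show ?thesis by simp
  qed
  have "(\<lambda>k. contour_integral (linepath (Complex (r + real k) (- 1)) (Complex (r + real k) 1)) ?f) \<longlonglongrightarrow> 0"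
  proof (rule Lim_null_comparison[OF _ lim0[of 2]], rule always_eventually, rule allI)
    fix k
    have "norm (contour_integral (linepath (Complex (r + real k) (- 1)) (Complex (r + real k) 1)) ?f)
      \<le> B / 2 ^ k * norm (Complex (r + real k) 1 - Complex (r + real k) (- 1))"
    proof (rule contour_integral_bound_linepath)
      have "r + real k = b1 + real (N + k) - 1 / 4" by (simp add: r_def)
      then show "?f contour_integrable_on linepath (Complex (r + real k) (- 1)) (Complex (r + real k) 1)"
        by (intro contour_integrable_continuous_linepath continuous_on_mellin_barnes no_pole)
           (metis closed_segment_vertical(1))
      fix s assume "s \<in> closed_segment (Complex (r + real k) (- 1)) (Complex (r + real k) 1)"
      then have "Re s = r + real k" "Im s \<in> closed_segment (- 1) 1"
        by (rule closed_segment_vertical)+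
      then have "s - of_nat k \<in> S"
        unfolding S by (auto simp: closed_segment_eq_real_ivl)
      then show "norm (?f s) \<le> B / 2 ^ k" by (rule decay)
    qed (use B in auto)
    also have "norm (Complex (r + real k) 1 - Complex (r + real k) (- 1)) = 2"
      by (simp add: cmod_def)
    finally show "norm (contour_integral (linepath (Complex (r + real k) (- 1)) (Complex (r + real k) 1)) ?f) \<le> 2 * (B / 2 ^ k)"
      by (simp only: mult.commute)
  qed
  moreover have "(\<lambda>k. \<Sum>j<k + N. residue_term b1 b2 L j) \<longlonglongrightarrow> suminf (residue_term b1 b2 L)"
    by (intro LIMSEQ_ignore_initial_segment summable_LIMSEQ sum1)
  moreover have "(\<lambda>k. \<Sum>j<k + (N + m + 1). residue_term b2 b1 L j) \<longlonglongrightarrow> suminf (residue_term b2 b1 L)"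
    by (intro LIMSEQ_ignore_initial_segment summable_LIMSEQ sum2)
  ultimately have "(\<lambda>k. J (r + real k)) \<longlonglongrightarrow> 0 + T"
    unfolding J_eq T_def by (intro tendsto_intros)
  then have lim_seq: "(\<lambda>k. J (r + real k)) \<longlonglongrightarrow> T" by simp
  \<comment> \<open>The index of the last good edge not beyond R, for R at least r; smaller R do not
    affect the limit.\<close>
  define \<kappa> where "\<kappa> = (\<lambda>R. nat \<lfloor>R - r\<rfloor>)"
  have \<kappa>_lim: "filterlim \<kappa> at_top at_top"
  proof -
    have "filterlim (\<lambda>R. R - r) at_top at_top"
      using filterlim_tendsto_add_at_top[OF tendsto_const filterlim_ident, of "- r"] by simp
    then show ?thesis
      unfolding \<kappa>_def
      by (intro filterlim_compose[OF filterlim_nat_sequentially] filterlim_compose[OF filterlim_floor_sequentially])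
  qed
  have "((\<lambda>R. J R - J (r + real (\<kappa> R))) \<longlongrightarrow> 0) at_top"
  proof (rule Lim_null_comparison)
    show "((\<lambda>R. 2 * (B / 2 ^ \<kappa> R)) \<longlongrightarrow> 0) at_top"
      by (rule filterlim_compose[OF lim0 \<kappa>_lim])
    show "\<forall>\<^sub>F R in at_top. norm (J R - J (r + real (\<kappa> R))) \<le> 2 * (B / 2 ^ \<kappa> R)"
      using eventually_ge_at_top[of r]
    proof eventually_elim
      case (elim R)
      define k where "k = \<kappa> R"
      have k: "r + real k \<le> R" "R \<le> r + real k + 1"
        using elim unfolding k_def \<kappa>_def by linarith+
      have cont: "continuous_on (closed_segment (Complex u t) (Complex v t)) ?f" if "\<bar>t\<bar> = 1" for u v t
        by (intro continuous_on_mellin_barnes no_pole) (use that in \<open>blast dest: closed_segment_horizontal(1)\<close>)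
      have cont_vert: "continuous_on (closed_segment (Complex (b2 - 1) (- 1)) (Complex (b2 - 1) 1)) ?f"
        by (intro continuous_on_mellin_barnes no_pole) (auto dest!: closed_segment_vertical(1))
      have le: "norm (contour_integral (linepath (Complex u t) (Complex v t)) ?f) \<le> B / 2 ^ k"
        if t: "\<bar>t\<bar> = 1" and uv: "u \<in> {r + real k..r + real k + 1}" "v \<in> {r + real k..r + real k + 1}" for u v t
      proof -
        have "norm (contour_integral (linepath (Complex u t) (Complex v t)) ?f) \<le> B / 2 ^ k * norm (Complex v t - Complex u t)"
        proof (rule contour_integral_bound_linepath)
          show "?f contour_integrable_on linepath (Complex u t) (Complex v t)"
            by (intro contour_integrable_continuous_linepath cont t)
          fix s assume "s \<in> closed_segment (Complex u t) (Complex v t)"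
          then have "Im s = t" "Re s \<in> closed_segment u v"
            by (rule closed_segment_horizontal)+
          then have "Im s \<in> {- 1, 1}" "Re s \<in> {r + real k..r + real k + 1}"
            using t uv by (auto simp: closed_segment_eq_real_ivl split: if_splits)
          then have "s - of_nat k \<in> S"
            unfolding S by auto
          then show "norm (?f s) \<le> B / 2 ^ k" by (rule decay)
        qed (use B in auto)
        also have "norm (Complex v t - Complex u t) = \<bar>v - u\<bar>"
          by (simp add: cmod_def)
        also have "B / 2 ^ k * \<bar>v - u\<bar> \<le> B / 2 ^ k * 1"
          using uv B by (intro mult_left_mono) auto
        finally show ?thesis by simp
      qed
      have "J R = J (r + real k)
          + contour_integral (linepath (Complex R (- 1)) (Complex (r + real k) (- 1))) ?f
          + contour_integral (linepath (Complex (r + real k) 1) (Complex R 1)) ?f"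
        unfolding J_def using R[of k] k by (intro loop_integral_extend cont cont_vert) auto
      then have "norm (J R - J (r + real k)) \<le>
          norm (contour_integral (linepath (Complex R (- 1)) (Complex (r + real k) (- 1))) ?f)
        + norm (contour_integral (linepath (Complex (r + real k) 1) (Complex R 1)) ?f)"
        by (simp add: norm_triangle_ineq)
      also have "\<dots> \<le> B / 2 ^ k + B / 2 ^ k"
        using k by (intro add_mono le) auto
      finally show ?case by (simp add: k_def)
    qed
  qed
  from tendsto_add[OF this filterlim_compose[OF lim_seq \<kappa>_lim]]
  have "(J \<longlongrightarrow> T) at_top" by simp
  then show ?thesis by (simp only: J_def T_def)
qed

section \<open>Residue series as Bessel series\<close>

lemma sin_plus_npi: "sin (z + of_nat k * complex_of_real pi) = (- 1) ^ k * sin z"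
proof (induction k)
  case (Suc k)
  have "sin (z + of_nat (Suc k) * complex_of_real pi) = sin ((z + of_nat k * of_real pi) + of_real pi)"
    by (simp add: algebra_simps)
  also have "\<dots> = - sin (z + of_nat k * of_real pi)"
    by (simp only: sin_add sin_of_real cos_of_real) simp
  finally show ?case using Suc by simp
qed simp

text \<open>The reflection formula replaces Gamma (-\<nu> - k) by the reciprocal of Gamma (1 + \<nu>
  + k). The sign (-1)^k it produces cancels that of the residue, which is why the modified Bessel
  series appears. Taking L = 2 Ln w makes exp (s L) a power of w on the chosen branch.\<close>

lemma residue_term_eq:
  fixes w :: complex
  assumes "b1 - b2 \<notin> \<int>" "w \<noteq> 0"
  shows "residue_term b1 b2 (2 * Ln w) k =
     - (of_real pi / sin (of_real (b1 - b2) * of_real pi)) * w powr (2 * of_real b1) *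
       (w ^ (2 * k) * rGamma (of_real (b1 - b2) + of_nat k + 1) / fact k)"
proof -
  define \<nu> where "\<nu> = complex_of_real (b1 - b2)"
  have \<nu>: "1 + \<nu> + of_nat k \<notin> \<int>\<^sub>\<le>\<^sub>0"
  proof
    assume "1 + \<nu> + of_nat k \<in> \<int>\<^sub>\<le>\<^sub>0"
    then obtain j where "1 + \<nu> + of_nat k = - of_nat j"
      by (elim nonpos_Ints_cases')
    then have "b1 - b2 = - real j - real k - 1"
      by (auto simp: complex_eq_iff \<nu>_def)
    then show False using assms(1) by auto
  qed
  have "1 - (- \<nu> - of_nat k) = 1 + \<nu> + of_nat k"
    by simp
  then have "Gamma (- \<nu> - of_nat k) * Gamma (1 + \<nu> + of_nat k) = of_real pi / sin (of_real pi * (- \<nu> - of_nat k))"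
    using Gamma_reflection_complex[of "- \<nu> - of_nat k"] by (simp only:)
  also have "of_real pi * (- \<nu> - of_nat k) = - (\<nu> * of_real pi + of_nat k * of_real pi)"
    by (simp add: algebra_simps)
  also have "of_real pi / sin (- (\<nu> * of_real pi + of_nat k * of_real pi)) = - ((- 1) ^ k * (of_real pi / sin (\<nu> * of_real pi)))"
    unfolding sin_minus sin_plus_npi by (cases "even k") auto
  finally have "Gamma (- \<nu> - of_nat k) * Gamma (1 + \<nu> + of_nat k) * rGamma (1 + \<nu> + of_nat k)
      = - ((- 1) ^ k * (of_real pi / sin (\<nu> * of_real pi))) * rGamma (1 + \<nu> + of_nat k)"
    by (simp only:)
  moreover have "Gamma (1 + \<nu> + of_nat k) * rGamma (1 + \<nu> + of_nat k) = 1"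
    using \<nu> by (simp add: rGamma_inverse_Gamma Gamma_eq_zero_iff)
  ultimately have "Gamma (- \<nu> - of_nat k) = - ((- 1) ^ k * (of_real pi / sin (\<nu> * of_real pi))) * rGamma (1 + \<nu> + of_nat k)"
    by (simp only: mult.assoc mult_1_right)
  moreover have "of_real b2 - of_real b1 - of_nat k = - \<nu> - of_nat k"
    by (simp add: \<nu>_def)
  ultimately have Gam: "Gamma (of_real b2 - of_real b1 - of_nat k) = - ((- 1) ^ k * (of_real pi / sin (\<nu> * of_real pi))) * rGamma (\<nu> + of_nat k + 1)"
    by (simp only: add_ac)
  have "(of_real b1 + of_nat k) * (2 * Ln w) = 2 * of_real b1 * Ln w + of_nat (2 * k) * Ln w"
    by (simp add: algebra_simps)
  then have "exp ((of_real b1 + of_nat k) * (2 * Ln w)) = w powr (2 * of_real b1) * w ^ (2 * k)"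
    using assms(2) by (simp only: exp_add exp_of_nat_mult) (simp add: powr_def)
  then have "residue_term b1 b2 (2 * Ln w) k = ((- 1) ^ k * (- 1) ^ k) * (- (of_real pi / sin (\<nu> * of_real pi)) * w powr (2 * of_real b1) *
       (w ^ (2 * k) * rGamma (\<nu> + of_nat k + 1) / fact k))"
    unfolding residue_term_def Gam by (cases "even k") (simp_all add: mult_ac)
  also have "(- 1) ^ k * (- 1) ^ k = (1 :: complex)"
    by (simp flip: power_mult_distrib)
  finally show ?thesis by (simp only: \<nu>_def mult_1_left)
qed

text \<open>Splitting the exponent 2 b1 as (b1 + b2) + (b1 - b2) isolates a factor symmetric in the
  parameters, common to both families.\<close>

lemma residue_terms_sums_bessel_I:
  fixes w :: complex
  assumes "b1 - b2 \<notin> \<int>" "w \<noteq> 0"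
  shows "residue_term b1 b2 (2 * Ln w) sums
     (- (of_real pi / sin (of_real (b1 - b2) * of_real pi)) * w powr (of_real (b1 + b2)) * bessel_I (of_real (b1 - b2)) (2 * w))"
proof -
  define \<nu> where "\<nu> = complex_of_real (b1 - b2)"
  have "w powr (2 * of_real b1) = w powr (of_real (b1 + b2)) * w powr \<nu>"
    by (simp add: \<nu>_def flip: powr_add)
  then have "- (of_real pi / sin (\<nu> * of_real pi)) * w powr (of_real (b1 + b2)) * bessel_I \<nu> (2 * w)
     = - (of_real pi / sin (\<nu> * of_real pi)) * w powr (2 * of_real b1) *
       (\<Sum>k. w ^ (2 * k) * rGamma (\<nu> + of_nat k + 1) / fact k)"
    by (simp add: bessel_I_def)
  moreover have "(\<lambda>k. - (of_real pi / sin (\<nu> * of_real pi)) * w powr (2 * of_real b1) *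
       (w ^ (2 * k) * rGamma (\<nu> + of_nat k + 1) / fact k)) sums
     (- (of_real pi / sin (\<nu> * of_real pi)) * w powr (2 * of_real b1) *
       (\<Sum>k. w ^ (2 * k) * rGamma (\<nu> + of_nat k + 1) / fact k))"
    by (intro sums_mult summable_sums bessel_series_summable)
  moreover have "residue_term b1 b2 (2 * Ln w) = (\<lambda>k. - (of_real pi / sin (\<nu> * of_real pi)) * w powr (2 * of_real b1) *
       (w ^ (2 * k) * rGamma (\<nu> + of_nat k + 1) / fact k))"
    by (intro ext) (simp only: residue_term_eq[OF assms] \<nu>_def)
  ultimately show ?thesis
    by (simp only: \<nu>_def)
qed

text \<open>Exchanging b1 and b2 replaces \<nu> by -\<nu> and flips the sign of the sine, so the two
  residue series combine to the difference that defines 2 K.\<close>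

lemma meijer_G2002_log_macdonald_K:
  fixes w :: complex
  assumes "w \<noteq> 0" and b1: "b1 = b2 + real m + 1 / 2"
  shows "meijer_G2002_log (2 * Ln w) (of_real b1) (of_real b2)
     = 2 * w powr (of_real (b1 + b2)) * macdonald_K (of_nat m + 1 / 2) (2 * w)"
proof -
  let ?L = "2 * Ln w"
  define \<nu> where "\<nu> = complex_of_real (b1 - b2)"
  have \<nu>: "\<nu> = of_nat m + 1 / 2"
    by (simp add: \<nu>_def b1)
  have "b1 - b2 \<notin> \<int>"
    using half_integer_real_not_Ints[of m] by (simp add: b1)
  moreover from this have "b2 - b1 \<notin> \<int>"
    using Ints_minus[of "b2 - b1"] by auto
  ultimately have sums: "residue_term b1 b2 ?L sums
      (- (of_real pi / sin (\<nu> * of_real pi)) * w powr (of_real (b1 + b2)) * bessel_I \<nu> (2 * w))"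
    "residue_term b2 b1 ?L sums
      (of_real pi / sin (\<nu> * of_real pi) * w powr (of_real (b1 + b2)) * bessel_I (- \<nu>) (2 * w))"
    using residue_terms_sums_bessel_I[of b1 b2 w] residue_terms_sums_bessel_I[of b2 b1 w] assms(1)
    by (auto simp: \<nu>_def minus_diff_eq[of "complex_of_real b1", symmetric] add.commute simp del: minus_diff_eq)
  have "(loop_integral (b2 - 1) 1 (mellin_barnes_integrand b1 b2 ?L) \<longlongrightarrow>
     2 * of_real pi * \<i> * (suminf (residue_term b1 b2 ?L) + suminf (residue_term b2 b1 ?L))) at_top"
    using sums by (intro tendsto_loop_integral[OF b1]) (auto simp: sums_iff)
  then have "((\<lambda>R. 1 / (2 * of_real pi * \<i>) * loop_integral (b2 - 1) 1 (mellin_barnes_integrand b1 b2 ?L) R) \<longlongrightarrow>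
     1 / (2 * of_real pi * \<i>) * (2 * of_real pi * \<i> * (suminf (residue_term b1 b2 ?L) + suminf (residue_term b2 b1 ?L)))) at_top"
    by (rule tendsto_mult_left)
  moreover have "1 / (2 * of_real pi * \<i>) * (2 * of_real pi * \<i> * z) = z" for z
    by simp
  ultimately have "((\<lambda>R. 1 / (2 * of_real pi * \<i>) * loop_integral (b2 - 1) 1 (mellin_barnes_integrand b1 b2 ?L) R) \<longlongrightarrow>
     suminf (residue_term b1 b2 ?L) + suminf (residue_term b2 b1 ?L)) at_top"
    by (simp only:)
  then have "Lim at_top (\<lambda>R. 1 / (2 * of_real pi * \<i>) * loop_integral (b2 - 1) 1 (mellin_barnes_integrand b1 b2 ?L) R)
     = suminf (residue_term b1 b2 ?L) + suminf (residue_term b2 b1 ?L)"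
    by (intro tendsto_Lim) auto
  moreover have "meijer_G2002_log ?L (of_real b1) (of_real b2) =
     Lim at_top (\<lambda>R. 1 / (2 * of_real pi * \<i>) * loop_integral (b2 - 1) 1 (mellin_barnes_integrand b1 b2 ?L) R)"
  proof -
    \<comment> \<open>The ordering of the parameters identifies the left edge of the loop in the
      definition.\<close>
    have "min b1 b2 - 1 = b2 - 1" by (simp add: b1)
    then show ?thesis
      unfolding meijer_G2002_log_def loop_integral_def mellin_barnes_integrand_def[abs_def] Let_def
      by (simp only: Re_complex_of_real Im_complex_of_real abs_zero max.idem add_0_left)
  qed
  moreover have "macdonald_K \<nu> (2 * w) = of_real pi / 2 * (bessel_I (- \<nu>) (2 * w) - bessel_I \<nu> (2 * w)) / sin (\<nu> * of_real pi)"
    unfolding macdonald_K_def Let_def \<nu> using half_integer_not_Ints[of m] by simp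
  moreover have "- (P / s) * W * I1 + P / s * W * I2 = 2 * W * (P / 2 * (I2 - I1) / s)" for P s W I1 I2 :: complex
    by (simp add: right_diff_distrib diff_divide_distrib mult_ac)
  ultimately show ?thesis
    unfolding \<nu>[symmetric] by (simp only: sums_unique[OF sums(1), symmetric] sums_unique[OF sums(2), symmetric])
qed

lemma meijer_G_bx_macdonald_K:
  assumes "b \<noteq> 0" "x > 0" and "b1 = b2 + real m + 1 / 2"
  shows "meijer_G_bx b x (of_real b1) (of_real b2)
     = 2 * (b * of_real x / 2) powr (of_real (b1 + b2)) * macdonald_K (of_nat m + 1 / 2) (b * of_real x)"
  using meijer_G2002_log_macdonald_K[of "b * of_real x / 2" b1 b2 m] assms
  by (simp add: meijer_G_bx_def)

section \<open>The series \<open>\<Upsilon>\<close>\<close>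

text \<open>For s \<le> 0 there is no convergent Gamma integral to compare with. Raising the
  exponent to r = max s 1 gives one, and the compensating factor \<open>t powr (s - r)\<close> is at
  most its value at the lower end z > 0.\<close>

lemma upper_Gamma_integrable:
  assumes "z > 0"
  shows "(\<lambda>t::real. t powr (s - 1) * exp (- t)) integrable_on {z..}"
proof -
  define r where "r = max s 1"
  have "(\<lambda>t::real. t powr (r - 1) / exp t) absolutely_integrable_on {0..}"
    using Gamma_integral_real[of r]
    by (intro nonnegative_absolutely_integrable_1 has_integral_integrable[of _ "Gamma r"]) (auto simp: r_def)
  then have "(\<lambda>t::real. t powr (r - 1) / exp t) absolutely_integrable_on {z..}"
    by (rule set_integrable_subset) (use assms in auto)
  then have g: "(\<lambda>t::real. z powr (s - r) * (t powr (r - 1) / exp t)) integrable_on {z..}"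
    by (intro integrable_on_mult_right set_lebesgue_integral_eq_integral(1))
  show ?thesis
  proof (rule measurable_bounded_by_integrable_imp_integrable_real[OF _ g])
    have "continuous_on {z..} (\<lambda>t::real. t powr (s - 1) * exp (- t))"
      using assms by (auto intro!: continuous_intros)
    then show "(\<lambda>t. t powr (s - 1) * exp (- t)) \<in> borel_measurable (lebesgue_on {z..})"
      by (rule continuous_imp_measurable_on_sets_lebesgue) auto
    fix t assume t: "t \<in> {z..}"
    have "t powr (s - r) \<le> z powr (s - r)"
      using assms t by (intro powr_mono2') (auto simp: r_def)
    moreover have "t powr (s - 1) = t powr (s - r) * t powr (r - 1)"
      by (simp flip: powr_add)
    ultimately show "\<bar>t powr (s - 1) * exp (- t)\<bar> \<le> z powr (s - r) * (t powr (r - 1) / exp t)"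
      by (simp add: exp_minus divide_inverse mult_right_mono flip: mult.assoc)
  qed auto
qed

text \<open>A non-integrable integrand has integral 0 by convention, so no case fails.\<close>

lemma upper_Gamma_nonneg: "upper_Gamma s z \<ge> 0"
  unfolding upper_Gamma_def
  by (cases "(\<lambda>t. t powr (s - 1) * exp (- t)) integrable_on {z..}")
     (auto intro!: integral_nonneg simp: not_integrable_integral)

lemma upper_Gamma_le_Gamma:
  assumes "z > 0" "s > 0"
  shows "upper_Gamma s z \<le> Gamma s"
proof -
  have "((\<lambda>t. t powr (s - 1) * exp (- t)) has_integral Gamma s) {0..}"
    using Gamma_integral_real[OF assms(2)] by (simp add: exp_minus divide_inverse)
  then show ?thesis
    unfolding upper_Gamma_def
    using assms upper_Gamma_integrable[OF assms(1)]
    by (intro has_integral_subset_le[OF _ integrable_integral]) auto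
qed

lemma has_field_derivative_upper_Gamma:
  assumes "z > 0"
  shows "(upper_Gamma s has_field_derivative - (z powr (s - 1) * exp (- z))) (at z)"
proof -
  define f where "f = (\<lambda>t::real. t powr (s - 1) * exp (- t))"
  \<comment> \<open>The fixed lower end z/2 keeps the fundamental theorem of calculus on a compact
    interval away from the singularity at 0.\<close>
  define l u where "l = z / 2" and "u = 2 * z"
  have lu: "l > 0" "z \<in> {l<..<u}"
    using assms by (auto simp: l_def u_def)
  have cont: "continuous_on {l..u} f"
    using lu unfolding f_def by (auto intro!: continuous_intros)
  have eq: "upper_Gamma s y = integral {l..} f - integral {l..y} f" if "y \<in> {l<..<u}" for y
  proof -
    have "(f has_integral integral {l..y} f + integral {y..} f) ({l..y} \<union> {y..})"
    proof (rule has_integral_Un)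
      show "(f has_integral integral {l..y} f) {l..y}"
        using that by (intro integrable_integral integrable_continuous_real continuous_on_subset[OF cont]) auto
      show "(f has_integral integral {y..} f) {y..}"
        unfolding f_def using that lu by (intro integrable_integral upper_Gamma_integrable) auto
      have "{l..y} \<inter> {y..} = {y}" using that by auto
      then show "negligible ({l..y} \<inter> {y..})" by simp
    qed
    moreover have "{l..y} \<union> {y..} = {l..}" using that by auto
    ultimately show ?thesis by (simp add: upper_Gamma_def f_def[symmetric] integral_unique)
  qed
  have "((\<lambda>y. integral {l..y} f) has_vector_derivative f z) (at z within {l..u})"
    using lu by (intro integral_has_vector_derivative cont) auto
  then have "((\<lambda>y. integral {l..y} f) has_real_derivative f z) (at z)"
    using lu by (subst (asm) at_within_interior) (auto simp: has_real_derivative_iff_has_vector_derivative)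
  then have "((\<lambda>y. integral {l..} f - integral {l..y} f) has_real_derivative - f z) (at z)"
    by (auto intro!: derivative_eq_intros)
  then have "(upper_Gamma s has_real_derivative - f z) (at z)"
    by (rule has_field_derivative_transform_within_open[of _ _ _ "{l<..<u}"]) (use lu eq in auto)
  then show ?thesis
    by (simp add: f_def)
qed

text \<open>From one term to the next the Gamma factor gains only k + c, while the factorial of 2k +
  j grows quadratically in k.\<close>

lemma summable_Gamma_ratio:
  fixes c :: real
  assumes "r > 0"
  shows "summable (\<lambda>k. r ^ k * Gamma (real k + c) / fact (2 * k + j))"
proof -
  \<comment> \<open>N ensures both k + c > 0, for the functional equation, and k \<ge> r (|c| + 1),
    for the ratio 1/2.\<close>
  obtain N :: nat where N: "\<bar>c\<bar> + r * (\<bar>c\<bar> + 1) + 1 < real N"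
    using reals_Archimedean2 by blast
  show ?thesis
  proof (rule summable_ratio_test[of "1/2" N])
    fix k assume "k \<ge> N"
    then have k: "real k \<ge> real N" by simp
    have pos: "0 \<le> r * (\<bar>c\<bar> + 1)" using assms by simp
    have kc: "real k + c > 0" using N k pos by linarith
    have Gam: "Gamma (real (Suc k) + c) = (real k + c) * Gamma (real k + c)"
    proof -
      have "real k + c \<notin> \<int>\<^sub>\<le>\<^sub>0" using kc by (auto elim!: nonpos_Ints_cases)
      then show ?thesis using Gamma_plus1[of "real k + c"] by (simp add: add_ac)
    qed
    have "r * (real k + c) \<le> (r * (\<bar>c\<bar> + 1)) * (real k + 1)"
    proof -
      have "real k + c \<le> (\<bar>c\<bar> + 1) * (real k + 1)"
        by (simp add: algebra_simps) (smt (verit) abs_ge_self mult_nonneg_nonneg of_nat_0_le_iff)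
      then show ?thesis using assms by (simp add: mult.assoc)
    qed
    also have "\<dots> \<le> real k * (real k + 1)"
      using N k by (intro mult_right_mono) auto
    finally have "2 * (r * (real k + c)) \<le> real (2 * k) * real (k + 1)"
      by (simp add: add.commute)
    also have "\<dots> \<le> real (2 * k + j + 1) * real (2 * k + j + 2)"
      by (intro mult_mono) auto
    finally have 1: "2 * (r * (real k + c)) \<le> real (2 * k + j + 1) * real (2 * k + j + 2)" .
    have "r ^ Suc k * Gamma (real (Suc k) + c) / fact (2 * Suc k + j)
      = (r ^ k * Gamma (real k + c) / fact (2 * k + j)) * (r * (real k + c) / (real (2 * k + j + 1) * real (2 * k + j + 2)))"
    proof -
      have "fact (2 * Suc k + j) = real (2 * k + j + 2) * (real (2 * k + j + 1) * fact (2 * k + j))"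
        by (simp flip: of_nat_mult)
      then show ?thesis unfolding Gam by (simp only: power_Suc times_divide_times_eq mult_ac)
    qed
    moreover have "\<bar>r * (real k + c) / (real (2 * k + j + 1) * real (2 * k + j + 2))\<bar> \<le> 1 / 2"
    proof -
      have D: "real (2 * k + j + 1) * real (2 * k + j + 2) > 0" by simp
      have "r * (real k + c) / (real (2 * k + j + 1) * real (2 * k + j + 2)) \<le> 1 / 2"
        using 1 D by (simp add: pos_divide_le_eq)
      moreover have "0 \<le> r * (real k + c) / (real (2 * k + j + 1) * real (2 * k + j + 2))"
        using assms kc by simp
      ultimately show ?thesis by linarith
    qed
    ultimately show "norm (r ^ Suc k * Gamma (real (Suc k) + c) / fact (2 * Suc k + j))
       \<le> 1 / 2 * norm (r ^ k * Gamma (real k + c) / fact (2 * k + j))"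
      by (simp only: real_norm_def abs_mult) (metis abs_ge_zero mult.commute mult_left_mono)
  qed simp
qed

text \<open>The comparison with the complete Gamma function holds only once k + c > 0, so finitely
  many terms are skipped. The base \<open>norm w + 1\<close> stays positive when w = 0.\<close>

lemma summable_upper_Gamma_series:
  assumes "z > 0"
  shows "summable (\<lambda>k. w ^ k * complex_of_real (upper_Gamma (real k + c) z) / fact (2 * k + j))"
proof (rule summable_comparison_test_ev)
  show "summable (\<lambda>k. (norm w + 1) ^ k * Gamma (real k + c) / fact (2 * k + j))"
    by (rule summable_Gamma_ratio) (simp add: add_nonneg_pos)
  show "\<forall>\<^sub>F k in sequentially. norm (w ^ k * complex_of_real (upper_Gamma (real k + c) z) / fact (2 * k + j))
      \<le> (norm w + 1) ^ k * Gamma (real k + c) / fact (2 * k + j)"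
    using eventually_gt_at_top[of "nat \<lceil>\<bar>c\<bar>\<rceil>"]
  proof eventually_elim
    case (elim k)
    then have "real k + c > 0" by linarith
    then have "upper_Gamma (real k + c) z \<le> Gamma (real k + c)"
      using assms by (intro upper_Gamma_le_Gamma)
    then have "norm w ^ k * upper_Gamma (real k + c) z \<le> (norm w + 1) ^ k * Gamma (real k + c)"
      by (intro mult_mono power_mono) (auto simp: upper_Gamma_nonneg)
    then show ?case
      by (simp add: norm_mult norm_divide norm_power upper_Gamma_nonneg divide_right_mono)
  qed
qed

lemma summable_Upsilon_term:
  assumes "a > 0" "x > 0"
  shows "summable (Upsilon_term \<upsilon> a b x)"
proof -
  \<comment> \<open>Each half of the term is a constant times w^k: the powers of b and a grow
    together.\<close>
  define w where "w = b\<^sup>2 / of_real a"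
  have z: "a * x\<^sup>2 > 0" using assms by simp
  have powr: "complex_of_real (a powr (- real k + c)) = of_real (a powr c) / of_real a ^ k" for k c
  proof -
    have "a powr (- real k + c) = a powr c / a ^ k"
      using assms powr_diff[of a c "real k"] by (simp add: powr_realpow)
    then show ?thesis by simp
  qed
  have eq: "b ^ (2 * k) * complex_of_real (a powr (- real k + c)) = of_real (a powr c) * w ^ k" for k c
    unfolding powr w_def by (simp add: power_divide power_mult)
  have "Upsilon_term \<upsilon> a b x k =
      b * of_real (a powr (\<upsilon> / 2 - 1)) / 2 *
        (w ^ k * complex_of_real (upper_Gamma (real k + (1 - \<upsilon> / 2)) (a * x\<^sup>2)) / fact (2 * k + 1))
    - of_real (a powr (\<upsilon> / 2 - 1 / 2)) / 2 *
        (w ^ k * complex_of_real (upper_Gamma (real k + (1 / 2 - \<upsilon> / 2)) (a * x\<^sup>2)) / fact (2 * k + 0))" for k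
  proof -
    have "real k - \<upsilon> / 2 + 1 = real k + (1 - \<upsilon> / 2)" "real k - \<upsilon> / 2 + 1 / 2 = real k + (1 / 2 - \<upsilon> / 2)"
      "- real k + \<upsilon> / 2 - 1 = - real k + (\<upsilon> / 2 - 1)" "- real k + \<upsilon> / 2 - 1 / 2 = - real k + (\<upsilon> / 2 - 1 / 2)"
      "b ^ (2 * k + 1) = b * b ^ (2 * k)"
      by simp_all
    then show ?thesis
      unfolding Upsilon_term_def by (simp only: mult.assoc eq) (simp add: mult_ac)
  qed
  then show ?thesis
    using summable_diff[OF summable_mult[OF summable_upper_Gamma_series[OF z]] summable_mult[OF summable_upper_Gamma_series[OF z]]]
    by presburger
qed

text \<open>Substituting t = a y^2 shows that
  \<open>a powr (- s) * upper_Gamma s (a * x\<^sup>2)\<close> is twice the integral of y^(2s-1) exp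
  (-a y^2) from x to infinity. Each term is thus minus such a tail for two consecutive Taylor terms
  of exp (-b y), and the powers of a cancel on differentiation.\<close>

lemma has_vector_derivative_Upsilon_term:
  assumes "a > 0" "x > 0"
  shows "((\<lambda>x. Upsilon_term \<upsilon> a b x k) has_vector_derivative
     of_real (x powr - \<upsilon> * exp (- (a * x\<^sup>2))) *
       ((b * of_real x) ^ (2 * k) / fact (2 * k) - (b * of_real x) ^ (2 * k + 1) / fact (2 * k + 1))) (at x)"
proof -
  have deriv: "((\<lambda>x. a powr (- s) * upper_Gamma s (a * x\<^sup>2)) has_real_derivative
      - 2 * x powr (2 * s - 1) * exp (- (a * x\<^sup>2))) (at x)" for s
  proof -
    have "((\<lambda>x. upper_Gamma s (a * x\<^sup>2)) has_real_derivative
        - ((a * x\<^sup>2) powr (s - 1) * exp (- (a * x\<^sup>2))) * (a * (2 * x))) (at x)"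
      using assms by (intro DERIV_chain2[of "upper_Gamma s", OF has_field_derivative_upper_Gamma])
        (auto intro!: derivative_eq_intros)
    then have "((\<lambda>x. a powr (- s) * upper_Gamma s (a * x\<^sup>2)) has_real_derivative
        a powr (- s) * (- ((a * x\<^sup>2) powr (s - 1) * exp (- (a * x\<^sup>2))) * (a * (2 * x)))) (at x)"
      by (rule DERIV_cmult)
    moreover have "a powr (- s) * (- ((a * x\<^sup>2) powr (s - 1) * exp (- (a * x\<^sup>2))) * (a * (2 * x)))
       = - 2 * x powr (2 * s - 1) * exp (- (a * x\<^sup>2))"
    proof -
      have "(x\<^sup>2) powr (s - 1) = x powr (2 * s - 2)"
        using assms by (simp add: powr_powr algebra_simps flip: powr_numeral)
      then have "(a * x\<^sup>2) powr (s - 1) = a powr (s - 1) * x powr (2 * s - 2)"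
        using assms by (simp add: powr_mult)
      moreover have "a powr (- s) * a powr (s - 1) * a = 1"
        using assms powr_add[of a "- s" "s - 1"] powr_minus[of a 1] by simp
      moreover have "x powr (2 * s - 2) * x = x powr (2 * s - 1)"
        using assms powr_add[of x "2 * s - 2" 1] by simp
      moreover have "A * (- ((B * X) * E) * (a * (2 * x))) = - 2 * (X * x) * E * (A * B * a)" for A B X E :: real
        by simp
      ultimately show ?thesis by (simp only: mult_1_right)
    qed
    ultimately show ?thesis by (simp only:)
  qed
  define s1 s2 where "s1 = real k - \<upsilon> / 2 + 1" and "s2 = real k - \<upsilon> / 2 + 1 / 2"
  have split_term: "Upsilon_term \<upsilon> a b x k =
      b ^ (2 * k + 1) / (2 * fact (2 * k + 1)) * of_real (a powr (- s1) * upper_Gamma s1 (a * x\<^sup>2))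
    - b ^ (2 * k) / (2 * fact (2 * k)) * of_real (a powr (- s2) * upper_Gamma s2 (a * x\<^sup>2))" for x
  proof -
    have "- real k + \<upsilon> / 2 - 1 = - s1" "- real k + \<upsilon> / 2 - 1 / 2 = - s2"
      by (simp_all add: s1_def s2_def)
    then show ?thesis
      unfolding Upsilon_term_def s1_def[symmetric] s2_def[symmetric] by (simp add: mult_ac del: fact_Suc)
  qed
  have "((\<lambda>x. Upsilon_term \<upsilon> a b x k) has_vector_derivative
     b ^ (2 * k + 1) / (2 * fact (2 * k + 1)) * of_real (- 2 * x powr (2 * s1 - 1) * exp (- (a * x\<^sup>2)))
    - b ^ (2 * k) / (2 * fact (2 * k)) * of_real (- 2 * x powr (2 * s2 - 1) * exp (- (a * x\<^sup>2)))) (at x)"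
    unfolding split_term
    by (intro has_vector_derivative_diff has_vector_derivative_mult_right has_vector_derivative_of_real deriv)
  moreover have "x powr (2 * s1 - 1) = x powr - \<upsilon> * x ^ (2 * k + 1)"
  proof -
    have "2 * s1 - 1 = - \<upsilon> + real (2 * k + 1)" by (simp add: s1_def)
    then show ?thesis using assms by (simp only: powr_add powr_realpow)
  qed
  moreover have "x powr (2 * s2 - 1) = x powr - \<upsilon> * x ^ (2 * k)"
  proof -
    have "2 * s2 - 1 = - \<upsilon> + real (2 * k)" by (simp add: s2_def)
    then show ?thesis using assms by (simp only: powr_add powr_realpow)
  qed
  moreover have "B / (2 * F) * of_real (- 2 * (P * X) * E) = - (of_real (P * E) * (B * of_real X / F))"
    for B F :: complex and P E X
    by simp
  ultimately show ?thesis
    by (simp only: power_mult_distrib of_real_power right_diff_distrib minus_diff_minus minus_diff_eq)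
qed

text \<open>Each differentiated term is a weight independent of the index times \<open>u\<close>.
  Locally the weight is bounded, so uniform convergence reduces to that of the exponential
  series.\<close>

lemma has_vector_derivative_Upsilon:
  assumes "a > 0" "x > 0"
  shows "(Upsilon \<upsilon> a b has_vector_derivative gauss_exp a b x / of_real (x powr \<upsilon>)) (at x)"
proof -
  \<comment> \<open>A neighbourhood bounded away from 0, where \<open>y powr - \<upsilon>\<close>
    may blow up, and bounded above, for the majorant in K.\<close>
  define S where "S = {x / 2<..<2 * x}"
  define u where "u = (\<lambda>(n::nat) y::real. (b * of_real y) ^ (2 * n) / fact (2 * n) - (b * of_real y) ^ (2 * n + 1) / fact (2 * n + 1))"
  define f' where "f' = (\<lambda>n y. complex_of_real (y powr - \<upsilon> * exp (- (a * y\<^sup>2))) * u n y)"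
  define g' where "g' = (\<lambda>y. complex_of_real (y powr - \<upsilon> * exp (- (a * y\<^sup>2))) * exp (- (b * of_real y)))"
  have S: "x \<in> S" "convex S" "open S" "\<And>y. y \<in> S \<Longrightarrow> y > 0"
    using assms by (auto simp: S_def)
  have u_sums: "(\<lambda>n. u n y) sums exp (- (b * of_real y))" for y
  proof -
    have "(\<lambda>n. (- (b * of_real y)) ^ n /\<^sub>R fact n) sums exp (- (b * of_real y))"
      by (rule exp_converges)
    \<comment> \<open>Consecutive terms are paired because \<open>Upsilon_term\<close> holds the
      Taylor terms of degrees 2n and 2n + 1 under one index.\<close>
    then have "(\<lambda>n. \<Sum>i\<in>{n * 2..<n * 2 + 2}. (- (b * of_real y)) ^ i /\<^sub>R fact i) sums exp (- (b * of_real y))"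
      by (rule sums_group) simp
    moreover have "(\<Sum>i\<in>{n * 2..<n * 2 + 2}. (- (b * of_real y)) ^ i /\<^sub>R fact i) = u n y" for n
    proof -
      have "{n * 2..<n * 2 + 2} = {2 * n, 2 * n + 1}" by auto
      then show ?thesis
        by (simp add: u_def scaleR_conv_of_real divide_inverse mult.commute del: fact_Suc)
    qed
    ultimately show ?thesis by simp
  qed
  define K where "K = norm b * (2 * x) + 1"
  have K: "K \<ge> 0" using assms by (simp add: K_def)
  have u_bound: "norm (u n y) \<le> K ^ (2 * n) / fact (2 * n) + K ^ (2 * n + 1) / fact (2 * n + 1)" if "y \<in> S" for n y
  proof -
    have "norm (b * of_real y) \<le> K"
    proof -
      have "norm b * \<bar>y\<bar> \<le> norm b * (2 * x)"
        using that S(4)[OF that] by (intro mult_left_mono) (auto simp: S_def)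
      then show ?thesis by (simp add: K_def norm_mult)
    qed
    then have "norm ((b * of_real y) ^ j / fact j) \<le> K ^ j / fact j" for j
      by (simp only: norm_divide norm_power norm_fact) (intro divide_right_mono power_mono; simp)
    then show ?thesis
      unfolding u_def by (intro order_trans[OF norm_triangle_ineq4] add_mono)
  qed
  have K_summable: "summable (\<lambda>n. K ^ (2 * n) / fact (2 * n) + K ^ (2 * n + 1) / fact (2 * n + 1))"
  proof -
    have "(\<lambda>n. K ^ n /\<^sub>R fact n) sums exp K"
      by (rule exp_converges)
    then have "(\<lambda>n. \<Sum>i\<in>{n * 2..<n * 2 + 2}. K ^ i /\<^sub>R fact i) sums exp K"
      by (rule sums_group) simp
    moreover have "(\<Sum>i\<in>{n * 2..<n * 2 + 2}. K ^ i /\<^sub>R fact i) = K ^ (2 * n) / fact (2 * n) + K ^ (2 * n + 1) / fact (2 * n + 1)" for n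
    proof -
      have "{n * 2..<n * 2 + 2} = {2 * n, 2 * n + 1}" by auto
      then show ?thesis
        by (simp add: divide_inverse mult.commute del: fact_Suc)
    qed
    ultimately show ?thesis by (simp add: sums_iff)
  qed
  have unif: "uniform_limit S (\<lambda>n y. \<Sum>i<n. u i y) (\<lambda>y. \<Sum>i. u i y) sequentially"
    using u_bound K_summable by (rule Weierstrass_m_test)
  obtain C where C: "C > 0" "\<And>y. y \<in> S \<Longrightarrow> norm (complex_of_real (y powr - \<upsilon> * exp (- (a * y\<^sup>2)))) \<le> C"
  proof -
    have "continuous_on {x / 2..2 * x} (\<lambda>y. y powr - \<upsilon> * exp (- (a * y\<^sup>2)))"
      using assms by (auto intro!: continuous_intros)
    then have "bounded ((\<lambda>y. y powr - \<upsilon> * exp (- (a * y\<^sup>2))) ` {x / 2..2 * x})"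
      by (intro compact_imp_bounded compact_continuous_image) auto
    then obtain C where "C > 0" "\<And>y. y \<in> {x / 2..2 * x} \<Longrightarrow> norm (y powr - \<upsilon> * exp (- (a * y\<^sup>2))) \<le> C"
      unfolding bounded_pos by blast
    moreover have "S \<subseteq> {x / 2..2 * x}"
      by (auto simp: S_def)
    ultimately show thesis
      by (intro that[of C]) (simp_all only: norm_of_real real_norm_def subset_iff)
  qed
  have "\<exists>g. \<forall>y\<in>S. (\<lambda>n. Upsilon_term \<upsilon> a b y n) sums g y \<and> (g has_derivative (\<lambda>h. h *\<^sub>R g' y)) (at y within S)"
  proof (rule has_derivative_series)
    fix n y assume y: "y \<in> S"
    show "((\<lambda>y. Upsilon_term \<upsilon> a b y n) has_derivative (\<lambda>h. h *\<^sub>R f' n y)) (at y within S)"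
      unfolding f'_def u_def
      by (rule has_derivative_at_withinI[OF
            has_vector_derivative_Upsilon_term[OF assms(1) S(4)[OF y], unfolded has_vector_derivative_def]])
  next
    show "(\<lambda>n. Upsilon_term \<upsilon> a b x n) sums (\<Sum>n. Upsilon_term \<upsilon> a b x n)"
      using summable_Upsilon_term[OF assms] by (rule summable_sums)
  next
    fix e :: real assume "e > 0"
    \<comment> \<open>The tolerance for the exponential series is divided by C to absorb the
      weight.\<close>
    then have "e / C > 0" using C by simp
    then have "\<forall>\<^sub>F n in sequentially. \<forall>y\<in>S. dist (\<Sum>i<n. u i y) (\<Sum>i. u i y) < e / C"
      by (rule uniform_limitD[OF unif])
    then show "\<forall>\<^sub>F n in sequentially. \<forall>y\<in>S. \<forall>h. norm ((\<Sum>i<n. h *\<^sub>R f' i y) - h *\<^sub>R g' y) \<le> e * norm h"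
    proof eventually_elim
      case (elim n)
      show ?case
      proof (intro ballI allI)
        fix y and h :: real assume y: "y \<in> S"
        let ?c = "complex_of_real (y powr - \<upsilon> * exp (- (a * y\<^sup>2)))"
        have "(\<Sum>i. u i y) = exp (- (b * of_real y))" using u_sums by (simp add: sums_iff)
        with elim y have le: "norm ((\<Sum>i<n. u i y) - exp (- (b * of_real y))) \<le> e / C"
          by (auto simp: dist_norm)
        have "(\<Sum>i<n. h *\<^sub>R f' i y) - h *\<^sub>R g' y = h *\<^sub>R (?c * ((\<Sum>i<n. u i y) - exp (- (b * of_real y))))"
          by (simp only: f'_def g'_def scaleR_sum_right sum_distrib_left scaleR_diff_right right_diff_distrib)
        then have "norm ((\<Sum>i<n. h *\<^sub>R f' i y) - h *\<^sub>R g' y) = \<bar>h\<bar> * (norm ?c * norm ((\<Sum>i<n. u i y) - exp (- (b * of_real y))))"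
          by (simp only: norm_scaleR norm_mult)
        also have "\<dots> \<le> \<bar>h\<bar> * (C * (e / C))"
          using C y le by (intro mult_left_mono mult_mono) auto
        also have "\<dots> = e * norm h" using C(1) by simp
        finally show "norm ((\<Sum>i<n. h *\<^sub>R f' i y) - h *\<^sub>R g' y) \<le> e * norm h" .
      qed
    qed
  qed (use S in auto)
  then obtain g where g': "\<forall>y\<in>S. (\<lambda>n. Upsilon_term \<upsilon> a b y n) sums g y \<and> (g has_derivative (\<lambda>h. h *\<^sub>R g' y)) (at y within S)"
    by (rule exE)
  note g = bspec[OF g', THEN conjunct1] bspec[OF g' S(1), THEN conjunct2]
  have "(g has_vector_derivative g' x) (at x)"
    using g(2) unfolding has_vector_derivative_def at_within_open[OF S(1) S(3)] .
  \<comment> \<open>The limit function g equals \<open>Upsilon\<close> only on S, which suffices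
    because S is open and contains x.\<close>
  then have "(Upsilon \<upsilon> a b has_vector_derivative g' x) (at x)"
    by (rule has_vector_derivative_transform_within_open[OF _ S(3,1)])
       (use g(1) in \<open>auto simp: Upsilon_def sums_iff\<close>)
  moreover have "g' x = gauss_exp a b x / of_real (x powr \<upsilon>)"
  proof -
    have "gauss_exp a b x = of_real (exp (- (a * x\<^sup>2))) * exp (- (b * of_real x))"
      unfolding gauss_exp_def exp_of_real[symmetric] by (simp flip: exp_add)
    then show ?thesis
      by (simp add: g'_def powr_minus divide_inverse)
  qed
  ultimately show ?thesis by simp
qed

section \<open>Error function antiderivatives\<close>

text \<open>The integrand is entire and hence has a primitive on the whole plane, so the integral
  along the segment depends only on its endpoint.\<close>

lemma has_field_derivative_erf:
  "(erf has_field_derivative 2 / of_real (sqrt pi) * exp (- z\<^sup>2)) (at z)"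
proof -
  have holo: "(\<lambda>t. exp (- t\<^sup>2)) holomorphic_on (UNIV :: complex set)"
    by (intro holomorphic_intros)
  obtain F where F: "\<And>z::complex. (F has_field_derivative exp (- z\<^sup>2)) (at z)"
  proof (rule holomorphic_convex_primitive'[OF convex_UNIV open_UNIV holo])
    fix g :: "complex \<Rightarrow> complex" assume "\<And>z::complex. z \<in> UNIV \<Longrightarrow> (g has_field_derivative exp (- z\<^sup>2)) (at z)"
    then show thesis by (intro that[of g]) auto
  qed
  have "contour_integral (linepath 0 z) (\<lambda>t. exp (- t\<^sup>2)) = F z - F 0" for z
    using contour_integral_primitive[of UNIV F "\<lambda>t. exp (- t\<^sup>2)" "linepath 0 z"] F
    by (auto intro: contour_integral_unique)
  then have erf: "erf = (\<lambda>z. 2 / of_real (sqrt pi) * (F z - F 0))"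
    by (simp add: erf_def fun_eq_iff)
  have "((\<lambda>z. F z - F 0) has_field_derivative exp (- z\<^sup>2)) (at z)"
    using F[of z] by (auto intro!: derivative_eq_intros)
  then show ?thesis
    unfolding erf by (rule DERIV_cmult)
qed

text \<open>For complex b the argument of \<open>erf\<close> leaves the real line, so the derivative
  is taken in a complex variable and then restricted to real x.\<close>

lemma has_vector_derivative_V00:
  assumes "a > 0"
  shows "(V00 a b has_vector_derivative gauss_exp a b x) (at x)"
proof -
  define r where "r = complex_of_real (sqrt a)"
  have r: "r \<noteq> 0" "r\<^sup>2 = of_real a"
    using assms by (auto simp: r_def simp flip: of_real_power)
  have inner: "((\<lambda>y. (2 * of_real a * y + b) / (2 * r)) has_field_derivative r) (at (of_real x))"
    using r by (auto intro!: derivative_eq_intros simp: field_simps power2_eq_square)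
  define z where "z = (2 * of_real a * of_real x + b) / (2 * r)"
  \<comment> \<open>Completing the square; the surplus b^2 / (4a) is what the exponential prefactor
    of \<open>V00\<close> compensates.\<close>
  have sq: "z\<^sup>2 = of_real a * (of_real x)\<^sup>2 + b * of_real x + b\<^sup>2 / (4 * of_real a)"
    using r by (simp add: z_def power_divide power_mult_distrib flip: r(2)) (simp add: field_simps power2_eq_square)
  have "((\<lambda>y. of_real (sqrt pi / (2 * sqrt a)) * exp (b\<^sup>2 / (4 * of_real a)) * erf ((2 * of_real a * y + b) / (2 * r)))
     has_field_derivative of_real (sqrt pi / (2 * sqrt a)) * exp (b\<^sup>2 / (4 * of_real a)) *
       (2 / of_real (sqrt pi) * exp (- z\<^sup>2) * r)) (at (of_real x))"
    unfolding z_def by (intro DERIV_cmult DERIV_chain2[of erf, OF has_field_derivative_erf inner])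
  then have "((\<lambda>y. of_real (sqrt pi / (2 * sqrt a)) * exp (b\<^sup>2 / (4 * of_real a)) * erf ((2 * of_real a * of_real y + b) / (2 * r)))
     has_vector_derivative of_real (sqrt pi / (2 * sqrt a)) * exp (b\<^sup>2 / (4 * of_real a)) *
       (2 / of_real (sqrt pi) * exp (- z\<^sup>2) * r)) (at x)"
    by (rule has_vector_derivative_real_field)
  moreover have "of_real (sqrt pi / (2 * sqrt a)) * exp (b\<^sup>2 / (4 * of_real a)) *
       (2 / of_real (sqrt pi) * exp (- z\<^sup>2) * r) = gauss_exp a b x"
  proof -
    have "of_real (sqrt pi / (2 * sqrt a)) * E * (2 / of_real (sqrt pi) * D * r) = E * D" for E D
      using r(1) by (simp add: r_def)
    moreover have "exp (b\<^sup>2 / (4 * of_real a)) * exp (- z\<^sup>2) = gauss_exp a b x"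
      unfolding sq gauss_exp_def by (simp flip: exp_add)
    ultimately show ?thesis by simp
  qed
  moreover have "V00 a b = (\<lambda>y. of_real (sqrt pi / (2 * sqrt a)) * exp (b\<^sup>2 / (4 * of_real a)) * erf ((2 * of_real a * of_real y + b) / (2 * r)))"
    by (simp add: V00_def r_def fun_eq_iff mult.assoc)
  ultimately show ?thesis by simp
qed

lemma has_vector_derivative_gauss_exp:
  "(gauss_exp a b has_vector_derivative - (2 * of_real (a * x) + b) * gauss_exp a b x) (at x)"
proof -
  have "((\<lambda>y. exp (- (of_real a * y\<^sup>2) - b * y)) has_field_derivative
     - (2 * of_real (a * x) + b) * exp (- (of_real a * (of_real x)\<^sup>2) - b * of_real x)) (at (of_real x))"
    by (auto intro!: derivative_eq_intros simp: algebra_simps)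
  then have "((\<lambda>y. exp (- (of_real a * (of_real y)\<^sup>2) - b * of_real y)) has_vector_derivative
     - (2 * of_real (a * x) + b) * exp (- (of_real a * (of_real x)\<^sup>2) - b * of_real x)) (at x)"
    by (rule has_vector_derivative_real_field)
  then show ?thesis
    by (simp add: gauss_exp_def[abs_def])
qed

lemma V10_eq:
  assumes "a > 0"
  shows "V10 a b x = - gauss_exp a b x / (2 * of_real a) - b / (2 * of_real a) * V00 a b x"
proof -
  have "a powr (3 / 2) = a * sqrt a"
    using assms powr_add[of a 1 "1 / 2"] by (simp add: powr_half_sqrt)
  then show ?thesis
    by (simp add: V10_def V00_def)
qed

text \<open>Differentiating -\<open>gauss_exp\<close> / (2a) gives x + b / (2a) times
  \<open>gauss_exp\<close>; the multiple of \<open>V00\<close> removes the surplus.\<close>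

lemma has_vector_derivative_V10:
  assumes "a > 0"
  shows "(V10 a b has_vector_derivative of_real x * gauss_exp a b x) (at x)"
proof -
  have "((\<lambda>x. - 1 / (2 * of_real a) * gauss_exp a b x - b / (2 * of_real a) * V00 a b x) has_vector_derivative
     - 1 / (2 * of_real a) * (- (2 * of_real (a * x) + b) * gauss_exp a b x) - b / (2 * of_real a) * gauss_exp a b x) (at x)"
    by (intro has_vector_derivative_diff has_vector_derivative_mult_right
       has_vector_derivative_gauss_exp has_vector_derivative_V00 assms)
  moreover have "- 1 / (2 * of_real a) * (- (2 * of_real (a * x) + b) * E) - b / (2 * of_real a) * E = of_real x * E" for E
    using assms by (simp add: field_simps)
  moreover have "V10 a b = (\<lambda>x. - 1 / (2 * of_real a) * gauss_exp a b x - b / (2 * of_real a) * V00 a b x)"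
    using V10_eq[OF assms] by (simp add: fun_eq_iff)
  ultimately show ?thesis by simp
qed

section \<open>Indefinite integrals\<close>

text \<open>One antiderivative determines all others, since the half-line is convex. It is also
  open, so values at x \<le> 0 do not affect derivatives at x > 0.\<close>

lemma indefinite_integral_eqI:
  assumes "\<And>x. x > 0 \<Longrightarrow> (R has_vector_derivative f x) (at x)"
  shows "indefinite_integral f = up_to_constant R"
proof (intro set_eqI iffI)
  fix F assume F: "F \<in> indefinite_integral f"
  have "((\<lambda>x. F x - R x) has_derivative (\<lambda>h. 0)) (at x within {0<..})" if "x > 0" for x
  proof -
    have "((\<lambda>x. F x - R x) has_vector_derivative f x - f x) (at x)"
      using F assms that by (intro has_vector_derivative_diff) (auto simp: indefinite_integral_def)
    then show ?thesis
      by (simp add: has_vector_derivative_def has_derivative_at_withinI)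
  qed
  then obtain c where "\<And>x. x \<in> {0<..} \<Longrightarrow> F x - R x = c"
    using has_derivative_zero_constant[of "{0::real<..}" "\<lambda>x. F x - R x"] by auto
  then have "\<forall>x>0. F x = R x + c"
    by (auto simp: algebra_simps)
  then show "F \<in> up_to_constant R"
    by (auto simp: up_to_constant_def)
next
  fix F assume "F \<in> up_to_constant R"
  then obtain c where c: "\<And>x. x > 0 \<Longrightarrow> F x = R x + c"
    by (auto simp: up_to_constant_def)
  have "(F has_vector_derivative f x) (at x)" if "x > 0" for x
  proof -
    have "((\<lambda>x. R x + c) has_vector_derivative f x) (at x)"
      using assms[OF that] by (auto intro!: derivative_eq_intros)
    then show ?thesis
      by (rule has_vector_derivative_transform_within_open[of _ _ _ "{0<..}"]) (use that c in auto)
  qed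
  then show "F \<in> indefinite_integral f"
    by (simp add: indefinite_integral_def)
qed

lemma indefinite_integral_cong:
  assumes "\<And>x. x > 0 \<Longrightarrow> f x = g x"
  shows "indefinite_integral f = indefinite_integral g"
  using assms by (simp add: indefinite_integral_def)

text \<open>The two parameters sum to 0, so the power factor in front of K is 1, and they differ by
  n + 1/2.\<close>

lemma V_eq_meijer_G:
  assumes "b \<noteq> 0"
  shows "V h n a b = indefinite_integral (\<lambda>x.
          complex_of_real (sqrt (2 / pi)) * complex_of_real (exp (- a * x\<^sup>2)) *
          b powr (of_nat n + 1 / 2) * complex_of_real (x powr (of_int h + 1 / 2)) *
          (1 / 2 * meijer_G_bx b x (of_nat n / 2 + 1 / 4) (- of_nat n / 2 - 1 / 4)))"
  unfolding V_def
proof (intro indefinite_integral_cong)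
  fix x :: real assume "x > 0"
  then have "meijer_G_bx b x (of_nat n / 2 + 1 / 4) (- of_nat n / 2 - 1 / 4) = 2 * macdonald_K (of_nat n + 1 / 2) (b * of_real x)"
    using meijer_G_bx_macdonald_K[OF assms, of x "real n / 2 + 1 / 4" "- real n / 2 - 1 / 4" n] assms
    by simp
  then show "complex_of_real (sqrt (2 / pi)) * complex_of_real (exp (- a * x\<^sup>2)) *
          b powr (of_nat n + 1 / 2) * complex_of_real (x powr (of_int h + 1 / 2)) *
          macdonald_K (of_nat n + 1 / 2) (b * of_real x)
     = complex_of_real (sqrt (2 / pi)) * complex_of_real (exp (- a * x\<^sup>2)) *
          b powr (of_nat n + 1 / 2) * complex_of_real (x powr (of_int h + 1 / 2)) *
          (1 / 2 * meijer_G_bx b x (of_nat n / 2 + 1 / 4) (- of_nat n / 2 - 1 / 4))"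
    by simp
qed

text \<open>Both parameters are lowered by 1/2 from 3/4 and -3/4. This multiplies G by the power
  -1/2 of b^2 x^2 / 4, which is 2 / (b x) on the chosen branch and accounts for the extra powers of
  b and x.\<close>

lemma V_0_1_eq_meijer_G:
  assumes "b \<noteq> 0"
  shows "V 0 1 a b = indefinite_integral (\<lambda>x.
          complex_of_real (sqrt (2 / pi)) * (b powr (5 / 2) / 2^2) * complex_of_real (exp (- a * x\<^sup>2)) *
          complex_of_real (x powr (1 / 2 + 1)) * meijer_G_bx b x (1 / 4) (- 5 / 4))"
  unfolding V_def
proof (intro indefinite_integral_cong)
  fix x :: real assume x: "x > 0"
  have "meijer_G_bx b x (1 / 4) (- 5 / 4) = 2 * (b * of_real x / 2) powr - 1 * macdonald_K (of_nat 1 + 1 / 2) (b * of_real x)"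
    using meijer_G_bx_macdonald_K[OF assms x, of "1 / 4" "- 5 / 4" 1] by simp
  moreover have "(b * of_real x / 2) powr - 1 = 2 / (b * of_real x)"
    using assms x by (simp add: powr_minus)
  moreover have "b powr (5 / 2) = b powr (of_nat 1 + 1 / 2) * b"
    using assms powr_add[of b "3 / 2" 1] by simp
  moreover have "x powr (1 / 2 + 1) = x powr (of_int 0 + 1 / 2) * x"
    using x powr_add[of x "1 / 2" 1] by simp
  moreover have "S * E * B * of_real X * K = S * (B * b / 2^2) * E * of_real (X * x) * (2 * (2 / (b * of_real x)) * K)"
    for S E B K :: complex and X
    using assms x by (simp add: field_simps)
  ultimately show "complex_of_real (sqrt (2 / pi)) * complex_of_real (exp (- a * x\<^sup>2)) *
          b powr (of_nat 1 + 1 / 2) * complex_of_real (x powr (of_int 0 + 1 / 2)) *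
          macdonald_K (of_nat 1 + 1 / 2) (b * of_real x)
     = complex_of_real (sqrt (2 / pi)) * (b powr (5 / 2) / 2^2) * complex_of_real (exp (- a * x\<^sup>2)) *
          complex_of_real (x powr (1 / 2 + 1)) * meijer_G_bx b x (1 / 4) (- 5 / 4)"
    by (simp only:)
qed

text \<open>The power -1/2 of b x / 2 in the closed form of K removes the half-integer parts of the
  exponents of b and x, leaving b^n and x^h.\<close>

lemma V_closed_form:
  assumes "b \<noteq> 0" "n \<in> {1..4}"
  shows "V h n a b = indefinite_integral (\<lambda>x.
          b ^ n * complex_of_real (x powi h) * p n (b * complex_of_real x) * gauss_exp a b x)"
  unfolding V_def
proof (intro indefinite_integral_cong)
  fix x :: real assume x: "x > 0"
  define P where "P = p n (b * complex_of_real x)"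
  define E where "E = exp (- (b * complex_of_real x))"
  have "(b * of_real x / 2) powr (- 1 / 2) = exp (- 1 / 2 * Ln (of_real (x / 2) * b))"
    using assms x by (simp add: powr_def mult.commute)
  also have "\<dots> = b powr (- 1 / 2) * of_real (x / 2) powr (- 1 / 2)"
  proof -
    have "- 1 / 2 * (u + v) = - 1 / 2 * v + - 1 / 2 * u" for u v :: complex
      by (simp add: field_simps)
    then have "exp (- 1 / 2 * (u + v)) = exp (- 1 / 2 * v) * exp (- 1 / 2 * u)" for u v :: complex
      by (simp only: exp_add)
    \<comment> \<open>A positive real factor leaves the argument unchanged, so the principal branch
      splits for every nonzero complex b.\<close>
    moreover have "Ln (of_real (x / 2) * b) = Ln (of_real (x / 2)) + Ln b"
      using assms x Ln_times_of_real[of "x / 2" b] by (simp add: Ln_of_real)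
    ultimately show ?thesis using assms x by (simp add: powr_def)
  qed
  also have "complex_of_real (x / 2) powr (- 1 / 2) = of_real ((x / 2) powr (- 1 / 2))"
    using x powr_of_real[of "x / 2" "- 1 / 2"] by simp
  also have "(x / 2) powr (- 1 / 2) = x powr (- 1 / 2) * sqrt 2"
  proof -
    have "2 powr (- 1 / 2) = inverse (sqrt 2)"
      using powr_minus[of 2 "1 / 2 :: real"] by (simp add: powr_half_sqrt)
    then show ?thesis using x by (simp only: powr_divide divide_inverse[of _ "inverse (sqrt 2)"] inverse_inverse_eq)
  qed
  finally have root: "(b * of_real x / 2) powr (- 1 / 2) = b powr (- 1 / 2) * of_real (x powr (- 1 / 2) * sqrt 2)" .
  have K: "macdonald_K (of_nat n + 1 / 2) (b * of_real x)
      = of_real (sqrt pi) / 2 * (b powr (- 1 / 2) * of_real (x powr (- 1 / 2) * sqrt 2)) * P * E"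
    using macdonald_K_half_integer_closed_form[of "b * of_real x" n] assms x root by (simp add: P_def E_def)
  have const: "complex_of_real (sqrt (2 / pi)) * of_real (sqrt pi) * of_real (sqrt 2) = 2"
  proof -
    have "sqrt (2 / pi) * sqrt pi * sqrt 2 = 2"
      by (simp add: real_sqrt_divide)
    then show ?thesis
      by (metis of_real_mult of_real_numeral)
  qed
  have bn: "b powr (of_nat n + 1 / 2) * b powr (- 1 / 2) = b ^ n"
    using assms(1) by (simp add: powr_nat' flip: powr_add)
  have xh: "x powr (of_int h + 1 / 2) * x powr (- 1 / 2) = x powi h"
    using x by (simp add: powr_real_of_int' flip: powr_add)
  have gauss: "gauss_exp a b x = of_real (exp (- a * x\<^sup>2)) * E"
    unfolding gauss_exp_def E_def exp_of_real[symmetric] by (simp flip: exp_add)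
  have "complex_of_real (sqrt (2 / pi)) * complex_of_real (exp (- a * x\<^sup>2)) *
          b powr (of_nat n + 1 / 2) * complex_of_real (x powr (of_int h + 1 / 2)) *
          macdonald_K (of_nat n + 1 / 2) (b * complex_of_real x)
     = (complex_of_real (sqrt (2 / pi)) * of_real (sqrt pi) * of_real (sqrt 2)) / 2
        * (b powr (of_nat n + 1 / 2) * b powr (- 1 / 2)) * of_real (x powr (of_int h + 1 / 2) * x powr (- 1 / 2))
        * P * (of_real (exp (- a * x\<^sup>2)) * E)"
    unfolding K by (simp only: of_real_mult) (simp only: times_divide_eq_left times_divide_eq_right mult_ac)
  then show "complex_of_real (sqrt (2 / pi)) * complex_of_real (exp (- a * x\<^sup>2)) *
          b powr (of_nat n + 1 / 2) * complex_of_real (x powr (of_int h + 1 / 2)) *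
          macdonald_K (of_nat n + 1 / 2) (b * complex_of_real x)
     = b ^ n * complex_of_real (x powi h) * p n (b * complex_of_real x) * gauss_exp a b x"
    unfolding const bn xh gauss[symmetric] P_def[symmetric] by simp
qed

text \<open>Keeping D apart from the integrand separates differentiating R, which determines D, from
  the algebraic identity.\<close>

lemma V_eq_up_to_constant:
  assumes "b \<noteq> 0" "n \<in> {1..4}"
    and "\<And>x. x > 0 \<Longrightarrow> (R has_vector_derivative D x) (at x)"
    and "\<And>x. x > 0 \<Longrightarrow> D x = b ^ n * complex_of_real (x powi h) * p n (b * complex_of_real x) * gauss_exp a b x"
  shows "V h n a b = up_to_constant R"
  unfolding V_closed_form[OF assms(1,2)]
  by (rule indefinite_integral_eqI) (use assms(3,4) in simp)

text \<open>The summability clause certifies that \<open>Upsilon\<close> is a genuine sum and not a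
  default value of the infinite sum.\<close>

theorem mainTheorem7:
  fixes a :: real and b :: complex
  assumes "a > 0" and "b \<noteq> 0"
  shows
    "(\<forall>h n. n \<ge> 1 \<longrightarrow>
        V h n a b = indefinite_integral (\<lambda>x.
          complex_of_real (sqrt (2 / pi)) * complex_of_real (exp (- a * x\<^sup>2)) *
          b powr (of_nat n + 1 / 2) * complex_of_real (x powr (of_int h + 1 / 2)) *
          (1 / 2 * meijer_G_bx b x (of_nat n / 2 + 1 / 4) (- of_nat n / 2 - 1 / 4)))) \<and>
     (\<forall>h. \<forall>n\<in>{1..4}.
        V h n a b = indefinite_integral (\<lambda>x.
          b ^ n * complex_of_real (x powi h) * p n (b * complex_of_real x) * gauss_exp a b x)) \<and>
     V 0 1 a b = indefinite_integral (\<lambda>x.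
          complex_of_real (sqrt (2 / pi)) * (b powr (5 / 2) / 2^2) * complex_of_real (exp (- a * x\<^sup>2)) *
          complex_of_real (x powr (1 / 2 + 1)) * meijer_G_bx b x (1 / 4) (- 5 / 4)) \<and>
     (\<forall>\<upsilon>. \<forall>x>0. summable (Upsilon_term \<upsilon> a b x)) \<and>
     (\<forall>\<upsilon>. indefinite_integral (\<lambda>x. gauss_exp a b x / complex_of_real (x powr \<upsilon>))
        = up_to_constant (Upsilon \<upsilon> a b)) \<and>
     indefinite_integral (\<lambda>x. complex_of_real x * gauss_exp a b x) = up_to_constant (V10 a b) \<and>
     V 0 1 a b = up_to_constant (\<lambda>x. Upsilon 1 a b x + b * Upsilon 0 a b x) \<and>
     V (-1) 2 a b = up_to_constant (\<lambda>x.
        3 * Upsilon 3 a b x + 3 * b * Upsilon 2 a b x + b^2 * Upsilon 1 a b x) \<and>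
     V 0 3 a b = up_to_constant (\<lambda>x.
        15 * Upsilon 3 a b x + 15 * b * Upsilon 2 a b x + 6 * b^2 * Upsilon 1 a b x
        + b^3 * Upsilon 0 a b x) \<and>
     V 1 3 a b = up_to_constant (\<lambda>x.
        15 * Upsilon 2 a b x + 15 * b * Upsilon 1 a b x + 6 * b^2 * Upsilon 0 a b x
        + b^3 * V10 a b x) \<and>
     V (-2) 3 a b = up_to_constant (\<lambda>x.
        15 * Upsilon 5 a b x + 15 * b * Upsilon 4 a b x + 6 * b^2 * Upsilon 3 a b x
        + b^3 * Upsilon 2 a b x) \<and>
     V 1 4 a b = up_to_constant (\<lambda>x.
        105 * Upsilon 3 a b x + 105 * b * Upsilon 2 a b x + 45 * b^2 * Upsilon 1 a b x
        + 10 * b^3 * Upsilon 0 a b x + b^4 * V10 a b x) \<and>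
     V (-1) 4 a b = up_to_constant (\<lambda>x.
        105 * Upsilon 5 a b x + 105 * b * Upsilon 4 a b x + 45 * b^2 * Upsilon 3 a b x
        + 10 * b^3 * Upsilon 2 a b x + b^4 * Upsilon 1 a b x) \<and>
     V (-3) 4 a b = up_to_constant (\<lambda>x.
        105 * Upsilon 7 a b x + 105 * b * Upsilon 6 a b x + 45 * b^2 * Upsilon 5 a b x
        + 10 * b^3 * Upsilon 4 a b x + b^4 * Upsilon 3 a b x) \<and>
     indefinite_integral (\<lambda>x. gauss_exp a b x) = up_to_constant (V00 a b) \<and>
     V 0 1 a b = up_to_constant (\<lambda>x. Upsilon 1 a b x + b * V00 a b x) \<and>
     V 1 4 a b = up_to_constant (\<lambda>x.
        105 * Upsilon 3 a b x + 105 * b * Upsilon 2 a b x + 45 * b^2 * Upsilon 1 a b x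
        + 10 * b^3 * V00 a b x + b^4 * V10 a b x)"
proof -
  note Upsilon = has_vector_derivative_Upsilon[OF \<open>a > 0\<close>]
    and V00 = has_vector_derivative_V00[OF \<open>a > 0\<close>] and V10 = has_vector_derivative_V10[OF \<open>a > 0\<close>]
  note derivs = has_vector_derivative_add has_vector_derivative_mult_right Upsilon V00 V10
  \<comment> \<open>In each closed form, a coefficient c of z^(-j) in \<open>p n\<close> contributes
    c b^(n-j) x^(h-j) times \<open>gauss_exp\<close>. Its antiderivative is a multiple of
    \<open>Upsilon (j - h)\<close>, or of \<open>V10\<close> when h - j = 1.\<close>
  have V01: "V 0 1 a b = up_to_constant (\<lambda>x. Upsilon 1 a b x + b * Upsilon 0 a b x)"
    by (rule V_eq_up_to_constant[OF \<open>b \<noteq> 0\<close>], simp, (rule derivs | assumption)+)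
       (simp add: p_def power_int_minus, simp add: \<open>b \<noteq> 0\<close> field_simps eval_nat_numeral)
  have V_12: "V (-1) 2 a b = up_to_constant (\<lambda>x.
      3 * Upsilon 3 a b x + 3 * b * Upsilon 2 a b x + b^2 * Upsilon 1 a b x)"
    by (rule V_eq_up_to_constant[OF \<open>b \<noteq> 0\<close>], simp, (rule derivs | assumption)+)
       (simp add: p_def power_int_minus, simp add: \<open>b \<noteq> 0\<close> field_simps eval_nat_numeral)
  \<comment> \<open>With h = 0 the index is j itself, from 3 down to 0; the combination ending in
    \<open>V10\<close> belongs to h = 1.\<close>
  have V03: "V 0 3 a b = up_to_constant (\<lambda>x.
      15 * Upsilon 3 a b x + 15 * b * Upsilon 2 a b x + 6 * b^2 * Upsilon 1 a b x
      + b^3 * Upsilon 0 a b x)"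
    by (rule V_eq_up_to_constant[OF \<open>b \<noteq> 0\<close>], simp, (rule derivs | assumption)+)
       (simp add: p_def power_int_minus, simp add: \<open>b \<noteq> 0\<close> field_simps eval_nat_numeral)
  have V13: "V 1 3 a b = up_to_constant (\<lambda>x.
      15 * Upsilon 2 a b x + 15 * b * Upsilon 1 a b x + 6 * b^2 * Upsilon 0 a b x
      + b^3 * V10 a b x)"
    by (rule V_eq_up_to_constant[OF \<open>b \<noteq> 0\<close>], simp, (rule derivs | assumption)+)
       (simp add: p_def power_int_minus, simp add: \<open>b \<noteq> 0\<close> field_simps eval_nat_numeral)
  have V_23: "V (-2) 3 a b = up_to_constant (\<lambda>x.
      15 * Upsilon 5 a b x + 15 * b * Upsilon 4 a b x + 6 * b^2 * Upsilon 3 a b x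
      + b^3 * Upsilon 2 a b x)"
    by (rule V_eq_up_to_constant[OF \<open>b \<noteq> 0\<close>], simp, (rule derivs | assumption)+)
       (simp add: p_def power_int_minus, simp add: \<open>b \<noteq> 0\<close> field_simps eval_nat_numeral)
  have V14: "V 1 4 a b = up_to_constant (\<lambda>x.
      105 * Upsilon 3 a b x + 105 * b * Upsilon 2 a b x + 45 * b^2 * Upsilon 1 a b x
      + 10 * b^3 * Upsilon 0 a b x + b^4 * V10 a b x)"
    by (rule V_eq_up_to_constant[OF \<open>b \<noteq> 0\<close>], simp, (rule derivs | assumption)+)
       (simp add: p_def power_int_minus, simp add: \<open>b \<noteq> 0\<close> field_simps eval_nat_numeral)
  have V_14: "V (-1) 4 a b = up_to_constant (\<lambda>x.
      105 * Upsilon 5 a b x + 105 * b * Upsilon 4 a b x + 45 * b^2 * Upsilon 3 a b x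
      + 10 * b^3 * Upsilon 2 a b x + b^4 * Upsilon 1 a b x)"
    by (rule V_eq_up_to_constant[OF \<open>b \<noteq> 0\<close>], simp, (rule derivs | assumption)+)
       (simp add: p_def power_int_minus, simp add: \<open>b \<noteq> 0\<close> field_simps eval_nat_numeral)
  have V_34: "V (-3) 4 a b = up_to_constant (\<lambda>x.
      105 * Upsilon 7 a b x + 105 * b * Upsilon 6 a b x + 45 * b^2 * Upsilon 5 a b x
      + 10 * b^3 * Upsilon 4 a b x + b^4 * Upsilon 3 a b x)"
    by (rule V_eq_up_to_constant[OF \<open>b \<noteq> 0\<close>], simp, (rule derivs | assumption)+)
       (simp add: p_def power_int_minus, simp add: \<open>b \<noteq> 0\<close> field_simps eval_nat_numeral)
  \<comment> \<open>For x > 0 the functions \<open>V00\<close> and \<open>Upsilon 0\<close> have the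
    same derivative, so either may represent the integral up to a constant.\<close>
  have V01': "V 0 1 a b = up_to_constant (\<lambda>x. Upsilon 1 a b x + b * V00 a b x)"
    by (rule V_eq_up_to_constant[OF \<open>b \<noteq> 0\<close>], simp, (rule derivs | assumption)+)
       (simp add: p_def power_int_minus, simp add: \<open>b \<noteq> 0\<close> field_simps eval_nat_numeral)
  have V14': "V 1 4 a b = up_to_constant (\<lambda>x.
      105 * Upsilon 3 a b x + 105 * b * Upsilon 2 a b x + 45 * b^2 * Upsilon 1 a b x
      + 10 * b^3 * V00 a b x + b^4 * V10 a b x)"
    by (rule V_eq_up_to_constant[OF \<open>b \<noteq> 0\<close>], simp, (rule derivs | assumption)+)
       (simp add: p_def power_int_minus, simp add: \<open>b \<noteq> 0\<close> field_simps eval_nat_numeral)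
  show ?thesis
    by (intro conjI allI ballI impI V_eq_meijer_G V_closed_form V_0_1_eq_meijer_G summable_Upsilon_term
        indefinite_integral_eqI Upsilon V00 V10 V01 V_12 V03 V13 V_23 V14 V_14 V_34 V01' V14' assms)
qed

end
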